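(* Suppose that for every element $\Omega_k$ there is a bijective, time-invariant polynomial mapping from $\hat\Omega$ onto $\Omega_k$ of degree $p_{\rm map}\le p+1$, that volume and facet quadrature rules exist such that degree-$p$ diagonal-norm SBP operators exist on the reference element, and that the metric terms are evaluated exactly. Then the SBP-SAT discretization of the diffusion problem described in the context is conservative if the penalty matrices satisfy $$T^{(1)}_{\gamma k}=T^{(1)}_{\gamma v},\qquad T^{(3)}_{\gamma k}+T^{(3)}_{\gamma v}=B_\gamma,\qquad T^{(5)}_{abk}=-T^{(6)}_{abk},$$ for all interior facets $\gamma$ (shared by $\Omega_k$ and $\Omega_v$) and all $a,b\in\{\gamma,\epsilon_1,\epsilon_2\}$ (distinct interior facets of $\Omega_k$), for every element $\Omega_k$.
   Context: **Problem.** $\Omega\subset\mathbb R^2$ is compact with piecewise smooth boundary $\Gamma^D\cup\Gamma^N$ ($\Gamma^D\ne\emptyset$), $\lambda$ is a symmetric positive definite (SPD) $2\times2$ tensor field. $\partial_t\mathcal U-\nabla\cdot(\lambda\nabla\mathcal U)=\mathcal F$ in $\Omega$, $\mathcal U=\mathcal U_0$ at $t=0$, $\mathcal U=\mathcal U_D$ on $\Gamma^D$, $(\lambda\nabla\mathcal U)\cdot n=\mathcal U_N$ on $\Gamma^N$. **Mesh.** $\Omega$ is partitioned into non-overlapping (possibly curved) triangles $\Omega_k$. $\Gamma_k$ denotes the facets (edges) of $\Omega_k$, $\Gamma_k^I$ those that are interior. For an interior facet $\gamma$ of $\Omega_k$, $\Omega_v$ is the neighbour across $\gamma$; $\epsilon\in\{\epsilon_1,\epsilon_2\}$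 runs over the other interior facets of $\Omega_k$ (neighbour $\Omega_g$ across $\epsilon$) and $\delta\in\{\delta_1,\delta_2\}$ over the other interior facets of $\Omega_v$ (neighbour $\Omega_q$ across $\delta$). **Reference SBP operators.** $\hat\Omega$ is the triangle with vertices $(-1,-1),(1,-1),(-1,1)$. A degree-$p$ diagonal-norm SBP operator on nodes $\{(\xi_i,\eta_i)\}_{i=1}^{n_p}$ is $\hat D_\xi=\hat H^{-1}\hat Q_\xi$ where $\hat D_\xi$ is exact at the nodes for polynomials of total degree $\le p$; $\hat H$ is diagonal SPD (a quadrature of degree at least $2p-1$); $\hat Q_\xi=\hat S_\xi+\frac12\hat E_\xi$ with $\hat S_\xi$ skew-symmetric, $\hat E_\xi$ symmetric and $\mathbf p^T\hat E_\xi\mathbf q=\int_{\hat\Gamma}\mathcal P\mathcal Q\,\hat n_\xi\,d\Gamma$ for polynomials of degree $\le r$, some $r\ge p$. Similarly for $\eta$. Moreover $\hat E_\xi=\sum_\gamma R_\gamma^T\hat B_\gamma\hat N_{\xi\gamma}R_\gamma$, where $\hat B_\gamma$ is diagonal with the positive weights of the Legendre–Gauss rule of degree $2p+1$ at the $n_f$ facet nodes, $\hat N_{\xi\gamma}$ is diagonal holding $\hat n_\xi$, and $R_\gamma\in\mathbb R^{n_f\times n_p}$ extrapolates from volume to facet nodes exactly for polynomials of degree $\le p$ (in particular $R_\gamma\mathbf 1=\mathbf 1$). **Physical operators.** Metric terms ($x_\xi$, etc.) are computed exactly from the polynomial mapping. $J_k$ is the diagonal matrix of $|x_\xi y_\eta-x_\eta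 y_\xi|$ at volume nodes, $J_{f_\gamma}$ the diagonal matrix of the facet arc-length scaling factor at facet nodes; $H_k=J_k\hat H$, $B_\gamma=J_{f_\gamma}\hat B_\gamma$, $R_{\gamma k}=R_\gamma$; $N_{x\gamma k},N_{y\gamma k}$ are diagonal matrices of the components of the outward unit normal at facet nodes; $E_{xk}=\sum_{\gamma\subset\Gamma_k}R_{\gamma k}^TB_\gamma N_{x\gamma k}R_{\gamma k}$, $E_{yk}$ analogous; with metrics at volume nodes, $S_{xk}=\frac12(\mathrm{diag}(y_\eta)\hat Q_\xi-\hat Q_\xi^T\mathrm{diag}(y_\eta))+\frac12(-\mathrm{diag}(y_\xi)\hat Q_\eta+\hat Q_\eta^T\mathrm{diag}(y_\xi))$, $S_{yk}=\frac12(-\mathrm{diag}(x_\eta)\hat Q_\xi+\hat Q_\xi^T\mathrm{diag}(x_\eta))+\frac12(\mathrm{diag}(x_\xi)\hat Q_\eta-\hat Q_\eta^T\mathrm{diag}(x_\xi))$; $D_{xk}=H_k^{-1}(S_{xk}+\frac12E_{xk})$, $D_{yk}=H_k^{-1}(S_{yk}+\frac12E_{yk})$. Known fact available under the mapping assumption: $D_{xk}\mathbf 1=D_{yk}\mathbf 1=\mathbf 0$. $\Lambda_k$ is the $2\times2$ block matrix with diagonal blocks holding the entries of $\lambda$ at the volume nodes. $D^{(2)}_k=[D_{xk}\; D_{yk}]\Lambda_k\begin{bmatrix}D_{xk}\\ D_{yk}\end{bmatrix}$ and $D_{\gamma k}=[N_{x\gamma k}R_{\gamma k}\;\; N_{y\gamma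 k}R_{\gamma k}]\Lambda_k\begin{bmatrix}D_{xk}\\ D_{yk}\end{bmatrix}$. **Discretization.** $\frac{du_{h,k}}{dt}=D^{(2)}_ku_{h,k}+f_k-H_k^{-1}s_k^I-H_k^{-1}s_k^B$, with $n_f\times n_f$ coefficient (penalty) matrices $T$ and $$s_k^I=\sum_{\gamma\subset\Gamma_k^I}[R_{\gamma k}^T\; D_{\gamma k}^T]\begin{bmatrix}T^{(1)}_{\gamma k}&T^{(3)}_{\gamma k}\\ T^{(2)}_{\gamma k}&T^{(4)}_{\gamma k}\end{bmatrix}\begin{bmatrix}R_{\gamma k}u_{h,k}-R_{\gamma v}u_{h,v}\\ D_{\gamma k}u_{h,k}+D_{\gamma v}u_{h,v}\end{bmatrix}+\sum_{\gamma\subset\Gamma_k^I}\Big\{\sum_{\epsilon}R_{\gamma k}^TT^{(5)}_{\gamma\epsilon k}[R_{\epsilon k}u_{h,k}-R_{\epsilon g}u_{h,g}]+\sum_{\delta}R_{\gamma k}^TT^{(6)}_{\gamma\delta v}[R_{\delta v}u_{h,v}-R_{\delta q}u_{h,q}]\Big\},$$ $$s_k^B=\sum_{\gamma\subset\Gamma^D\cap\Gamma_k}[R_{\gamma k}^T\; D_{\gamma k}^T]\begin{bmatrix}T_\gamma^{(D)}\\ -B_\gamma\end{bmatrix}(R_{\gamma k}u_{h,k}-u_{\gamma k})+\sum_{\gamma\subset\Gamma^N\cap\Gamma_k}R_{\gamma k}^TB_\gamma(D_{\gamma k}u_{h,k}-w_{\gamma k}),$$ $f_k$ the nodal values of $\mathcal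 F$; $u_{\gamma k},w_{\gamma k}$ the restrictions of the Dirichlet and Neumann data to the facet nodes. **Conservative** means that the divergence theorem holds discretely: when there is no source term ($f_k=0$), $\sum_k\mathbf 1^TH_k\frac{du_{h,k}}{dt}$ equals a sum of boundary-facet terms only (all volume and interior-facet contributions vanish), namely $$\sum_{\gamma\subset\Gamma^N}\mathbf 1^TR_{\gamma k}^TB_\gamma w_{\gamma k}+\sum_{\gamma\subset\Gamma^D}\big[\mathbf 1^TR_{\gamma k}^TB_\gamma D_{\gamma k}u_{h,k}-\mathbf 1^TR_{\gamma k}^TT_\gamma^{(D)}(R_{\gamma k}u_{h,k}-u_{\gamma k})\big].$$
   Formalization: The mappings are additionally assumed to have positive Jacobian determinant on the closed reference triangle; for orientation-reversing mappings the given S_x, S_y do not satisfy D_x 1 = D_y 1 = 0 and conservation fails. *)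

theory Defs
  imports "HOL-Analysis.Analysis" "HOL-Computational_Algebra.Polynomial"
begin

type_synonym point = "real \<times> real"

definition diag :: "real^'n \<Rightarrow> real^'n^'n" where
  "diag v = (\<chi> i j. if i = j then v $ i else 0)"

definition spd :: "real^'n^'n \<Rightarrow> bool" where
  "spd A \<longleftrightarrow> transpose A = A \<and> (\<forall>v. v \<noteq> 0 \<longrightarrow> v \<bullet> (A *v v) > 0)"

text \<open>Bivariate polynomial functions of total degree at most \<open>d\<close>.\<close>

definition poly2 :: "nat \<Rightarrow> (point \<Rightarrow> real) set" where
  "poly2 d = {f. \<exists>c :: nat \<Rightarrow> nat \<Rightarrow> real. \<forall>x y.
     f (x, y) = (\<Sum>i\<le>d. \<Sum>j\<le>d - i. c i j * x ^ i * y ^ j)}"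

definition d_xi :: "(point \<Rightarrow> real) \<Rightarrow> point \<Rightarrow> real" where
  "d_xi f = (\<lambda>(x, y). deriv (\<lambda>a. f (a, y)) x)"

definition d_eta :: "(point \<Rightarrow> real) \<Rightarrow> point \<Rightarrow> real" where
  "d_eta f = (\<lambda>(x, y). deriv (\<lambda>b. f (x, b)) y)"


section \<open>Reference element\<close>

text \<open>Vertices and facets are indexed by the type \<open>3\<close>, whose arithmetic is modulo 3. Facet \<open>i\<close>
  joins vertex \<open>i\<close> to vertex \<open>i + 1\<close>; \<open>ref_facet i\<close> parametrizes it affinely over \<open>[-1, 1]\<close>,
  counterclockwise.\<close>

definition ref_vertex :: "3 \<Rightarrow> point" where
  "ref_vertex i = (if i = 1 then (-1, -1) else if i = 2 then (1, -1) else (-1, 1))"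

definition ref_triangle :: "point set" where
  "ref_triangle = convex hull (range ref_vertex)"

definition ref_facet :: "3 \<Rightarrow> real \<Rightarrow> point" where
  "ref_facet i s = ((1 - s) / 2) *\<^sub>R ref_vertex i + ((1 + s) / 2) *\<^sub>R ref_vertex (i + 1)"

definition ref_tangent :: "3 \<Rightarrow> point" where
  "ref_tangent i = (1 / 2) *\<^sub>R (ref_vertex (i + 1) - ref_vertex i)"

definition ref_normal :: "3 \<Rightarrow> point" where
  "ref_normal i =
     (1 / norm (ref_tangent i)) *\<^sub>R (snd (ref_tangent i), - fst (ref_tangent i))"

definition ref_boundary_integral :: "(3 \<Rightarrow> point \<Rightarrow> real) \<Rightarrow> real" where
  "ref_boundary_integral f =
     (\<Sum>i\<in>UNIV. integral {-1..1} (\<lambda>s. f i (ref_facet i s) * norm (ref_tangent i)))"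

text \<open>The \<open>(p + 1)\<close>-point Gauss rule on \<open>[-1, 1]\<close> for the weight \<open>1\<close>. The numbering of the nodes
  is arbitrary.\<close>

definition legendre_gauss :: "nat \<Rightarrow> ('f::finite \<Rightarrow> real) \<Rightarrow> ('f \<Rightarrow> real) \<Rightarrow> bool" where
  "legendre_gauss p s w \<longleftrightarrow>
     CARD('f) = p + 1 \<and> inj s \<and> (\<forall>m. -1 < s m \<and> s m < 1 \<and> 0 < w m) \<and>
     (\<forall>q :: real poly. degree q \<le> 2 * p + 1 \<longrightarrow>
        (\<Sum>m\<in>UNIV. w m * poly q (s m)) = integral {-1..1} (poly q))"

text \<open>\<open>Hhat\<close> is the diagonal of the norm matrix; \<open>Rhat i\<close> extrapolates from the volume nodes to
  the facet nodes \<open>ref_facet i (gs m)\<close>.\<close>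

record ('n, 'f) sbp_op =
  node :: "'n::finite \<Rightarrow> point"
  Hhat :: "real^'n"
  Sxi  :: "real^'n^'n"
  Seta :: "real^'n^'n"
  Rhat :: "3 \<Rightarrow> real^'n^('f::finite)"
  gs   :: "'f \<Rightarrow> real"
  gw   :: "'f \<Rightarrow> real"

definition at_nodes :: "('n::finite, 'f::finite) sbp_op \<Rightarrow> (point \<Rightarrow> real) \<Rightarrow> real^'n" where
  "at_nodes P f = (\<chi> a. f (node P a))"

text \<open>The Gauss weights rescaled to the arc length of the reference facet.\<close>

definition bhat :: "('n::finite, 'f::finite) sbp_op \<Rightarrow> 3 \<Rightarrow> real^'f" where
  "bhat P i = (\<chi> m. norm (ref_tangent i) * gw P m)"

definition Exi :: "('n::finite, 'f::finite) sbp_op \<Rightarrow> real^'n^'n" where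
  "Exi P = (\<Sum>i\<in>UNIV. transpose (Rhat P i) ** diag (bhat P i)
                       ** diag (\<chi> m. fst (ref_normal i)) ** Rhat P i)"

definition Eeta :: "('n::finite, 'f::finite) sbp_op \<Rightarrow> real^'n^'n" where
  "Eeta P = (\<Sum>i\<in>UNIV. transpose (Rhat P i) ** diag (bhat P i)
                        ** diag (\<chi> m. snd (ref_normal i)) ** Rhat P i)"

definition Qxi :: "('n::finite, 'f::finite) sbp_op \<Rightarrow> real^'n^'n" where
  "Qxi P = Sxi P + (1 / 2) *\<^sub>R Exi P"

definition Qeta :: "('n::finite, 'f::finite) sbp_op \<Rightarrow> real^'n^'n" where
  "Qeta P = Seta P + (1 / 2) *\<^sub>R Eeta P"

definition Dxi :: "('n::finite, 'f::finite) sbp_op \<Rightarrow> real^'n^'n" where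
  "Dxi P = matrix_inv (diag (Hhat P)) ** Qxi P"

definition Deta :: "('n::finite, 'f::finite) sbp_op \<Rightarrow> real^'n^'n" where
  "Deta P = matrix_inv (diag (Hhat P)) ** Qeta P"

text \<open>The bound \<open>d < 2 * p\<close> expresses degree at most \<open>2p - 1\<close> without truncated subtraction.\<close>

definition sbp_operator :: "nat \<Rightarrow> ('n::finite, 'f::finite) sbp_op \<Rightarrow> bool" where
  "sbp_operator p P \<longleftrightarrow>
     inj (node P) \<and> (\<forall>a. node P a \<in> ref_triangle) \<and>
     spd (diag (Hhat P)) \<and>
     (\<forall>d f. d < 2 * p \<and> f \<in> poly2 d \<longrightarrow> Hhat P \<bullet> at_nodes P f = integral ref_triangle f) \<and>
     transpose (Sxi P) = - Sxi P \<and>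
     transpose (Seta P) = - Seta P \<and>
     (\<forall>f \<in> poly2 p. Dxi P *v at_nodes P f = at_nodes P (d_xi f)) \<and>
     (\<forall>f \<in> poly2 p. Deta P *v at_nodes P f = at_nodes P (d_eta f)) \<and>
     legendre_gauss p (gs P) (gw P) \<and>
     (\<forall>i. \<forall>f \<in> poly2 p. Rhat P i *v at_nodes P f = (\<chi> m. f (ref_facet i (gs P m)))) \<and>
     (\<exists>r\<ge>p. \<forall>f \<in> poly2 r. \<forall>g \<in> poly2 r.
        at_nodes P f \<bullet> (Exi P *v at_nodes P g)
          = ref_boundary_integral (\<lambda>i z. f z * g z * fst (ref_normal i))) \<and>
     (\<exists>r\<ge>p. \<forall>f \<in> poly2 r. \<forall>g \<in> poly2 r.
        at_nodes P f \<bullet> (Eeta P *v at_nodes P g)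
          = ref_boundary_integral (\<lambda>i z. f z * g z * snd (ref_normal i)))"


section \<open>Diffusion problem and mesh\<close>

record problem =
  omega     :: "point set"
  bdry_D    :: "point set"
  bdry_N    :: "point set"
  lam       :: "point \<Rightarrow> real^2^2"
  source    :: "real \<Rightarrow> point \<Rightarrow> real"
  dirichlet :: "real \<Rightarrow> point \<Rightarrow> real"
  neumann   :: "real \<Rightarrow> point \<Rightarrow> real"

definition diffusion_problem :: "problem \<Rightarrow> bool" where
  "diffusion_problem A \<longleftrightarrow>
     compact (omega A) \<and> bdry_D A \<union> bdry_N A = frontier (omega A) \<and> bdry_D A \<noteq> {} \<and>
     (\<forall>z \<in> omega A. spd (lam A z))"

text \<open>Elements are indexed by \<open>'k\<close>, and facet \<open>i\<close> of element \<open>k\<close> is addressed by the pair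
  \<open>k, i\<close>. The two elements sharing a facet traverse it in opposite directions, so the facet nodes of
  the reference element need renumbering before the two sides can be compared: the \<open>m\<close>-th node
  of facet \<open>k, i\<close> is the image of the reference facet node with index \<open>fnum k i m\<close>, and
  \<open>nrm k i m\<close> is the outward unit normal there.\<close>

record ('k, 'f) mesh =
  emap :: "'k \<Rightarrow> point \<Rightarrow> point"
  fnum :: "'k \<Rightarrow> 3 \<Rightarrow> 'f \<Rightarrow> 'f"
  nrm  :: "'k \<Rightarrow> 3 \<Rightarrow> 'f \<Rightarrow> point"

definition jacobian :: "(point \<Rightarrow> point) \<Rightarrow> point \<Rightarrow> real" where
  "jacobian \<phi> z = d_xi (fst \<circ> \<phi>) z * d_eta (snd \<circ> \<phi>) z - d_eta (fst \<circ> \<phi>) z * d_xi (snd \<circ> \<phi>) z"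

definition facet_tangent :: "(point \<Rightarrow> point) \<Rightarrow> 3 \<Rightarrow> real \<Rightarrow> point" where
  "facet_tangent \<phi> i s = vector_derivative (\<lambda>t. \<phi> (ref_facet i t)) (at s)"

definition outward_unit_normal :: "(point \<Rightarrow> point) \<Rightarrow> 3 \<Rightarrow> real \<Rightarrow> point \<Rightarrow> bool" where
  "outward_unit_normal \<phi> i s \<nu> \<longleftrightarrow>
     norm \<nu> = 1 \<and> \<nu> \<bullet> facet_tangent \<phi> i s = 0 \<and>
     (\<forall>\<^sub>F h in at_right 0. \<phi> (ref_facet i s) + h *\<^sub>R \<nu> \<notin> \<phi> ` ref_triangle)"

definition element :: "('k, 'f) mesh \<Rightarrow> 'k \<Rightarrow> point set" where
  "element M k = emap M k ` ref_triangle"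

definition facet :: "('k, 'f) mesh \<Rightarrow> 'k \<Rightarrow> 3 \<Rightarrow> point set" where
  "facet M k i = emap M k ` ref_facet i ` {-1..1}"

definition adjacent :: "('k, 'f) mesh \<Rightarrow> 'k \<Rightarrow> 3 \<Rightarrow> 'k \<Rightarrow> 3 \<Rightarrow> bool" where
  "adjacent M k i v j \<longleftrightarrow> v \<noteq> k \<and> facet M v j = facet M k i"

definition interior_facet :: "('k, 'f) mesh \<Rightarrow> 'k \<Rightarrow> 3 \<Rightarrow> bool" where
  "interior_facet M k i \<longleftrightarrow> (\<exists>v j. adjacent M k i v j)"

definition D_facet :: "('k, 'f) mesh \<Rightarrow> problem \<Rightarrow> 'k \<Rightarrow> 3 \<Rightarrow> bool" where
  "D_facet M A k i \<longleftrightarrow> facet M k i \<subseteq> bdry_D A"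

definition N_facet :: "('k, 'f) mesh \<Rightarrow> problem \<Rightarrow> 'k \<Rightarrow> 3 \<Rightarrow> bool" where
  "N_facet M A k i \<longleftrightarrow> facet M k i \<subseteq> bdry_N A"

text \<open>The neighbouring element together with its index for the shared facet.\<close>

definition neighbour :: "('k, 'f) mesh \<Rightarrow> 'k \<Rightarrow> 3 \<Rightarrow> 'k \<times> 3" where
  "neighbour M k i = (THE vj. adjacent M k i (fst vj) (snd vj))"

definition facet_node ::
  "('n::finite, 'f::finite) sbp_op \<Rightarrow> ('k, 'f) mesh \<Rightarrow> 'k \<Rightarrow> 3 \<Rightarrow> 'f \<Rightarrow> point" where
  "facet_node P M k i m = emap M k (ref_facet i (gs P (fnum M k i m)))"

text \<open>The Jacobian determinant is required to be positive, that is, the mappings preserve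
  orientation: with the opposite sign, \<open>Sx\<close> and \<open>Sy\<close> below would have the wrong sign relative to
  the boundary matrices \<open>Ex\<close> and \<open>Ey\<close> formed with the outward normal.\<close>

definition conforming_mesh ::
  "nat \<Rightarrow> ('n::finite, 'f::finite) sbp_op \<Rightarrow> problem \<Rightarrow> ('k::finite, 'f) mesh \<Rightarrow> bool" where
  "conforming_mesh p P A M \<longleftrightarrow>
     (\<forall>k. fst \<circ> emap M k \<in> poly2 (p + 1) \<and> snd \<circ> emap M k \<in> poly2 (p + 1) \<and>
          bij_betw (emap M k) ref_triangle (element M k) \<and>
          (\<forall>z \<in> ref_triangle. jacobian (emap M k) z > 0)) \<and>
     (\<Union>k. element M k) = omega A \<and>
     (\<forall>k l. k \<noteq> l \<longrightarrow> interior (element M k) \<inter> interior (element M l) = {}) \<and>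
     (\<forall>k i. interior_facet M k i \<or> D_facet M A k i \<or> N_facet M A k i) \<and>
     (\<forall>k i. \<not> (interior_facet M k i \<and> D_facet M A k i) \<and>
            \<not> (interior_facet M k i \<and> N_facet M A k i) \<and>
            \<not> (D_facet M A k i \<and> N_facet M A k i)) \<and>
     (\<forall>k i. interior_facet M k i \<longrightarrow> (\<exists>!vj. adjacent M k i (fst vj) (snd vj))) \<and>
     (\<forall>k i. bij (fnum M k i)) \<and>
     (\<forall>k i v j m. adjacent M k i v j \<longrightarrow> facet_node P M k i m = facet_node P M v j m) \<and>
     (\<forall>k i m. outward_unit_normal (emap M k) i (gs P (fnum M k i m)) (nrm M k i m))"


section \<open>Physical operators\<close>

definition Hk :: "('n::finite, 'f::finite) sbp_op \<Rightarrow> ('k, 'f) mesh \<Rightarrow> 'k \<Rightarrow> real^'n^'n" where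
  "Hk P M k = diag (\<chi> a. \<bar>jacobian (emap M k) (node P a)\<bar>) ** diag (Hhat P)"

text \<open>\<open>Jf\<close> is the ratio of physical to reference arc length. On an interior facet, \<open>Bf\<close> does
  not depend on the side: both parametrizations have degree at most \<open>p + 1\<close> and agree, up to
  reversal, at the \<open>p + 1\<close> facet nodes and at both end points, hence everywhere.\<close>

definition Jf :: "('n::finite, 'f::finite) sbp_op \<Rightarrow> ('k, 'f) mesh \<Rightarrow> 'k \<Rightarrow> 3 \<Rightarrow> real^'f" where
  "Jf P M k i = (\<chi> m. norm (facet_tangent (emap M k) i (gs P (fnum M k i m))) / norm (ref_tangent i))"

definition Bf :: "('n::finite, 'f::finite) sbp_op \<Rightarrow> ('k, 'f) mesh \<Rightarrow> 'k \<Rightarrow> 3 \<Rightarrow> real^'f^'f" where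
  "Bf P M k i = diag (Jf P M k i) ** diag (\<chi> m. bhat P i $ fnum M k i m)"

definition Rf :: "('n::finite, 'f::finite) sbp_op \<Rightarrow> ('k, 'f) mesh \<Rightarrow> 'k \<Rightarrow> 3 \<Rightarrow> real^'n^'f" where
  "Rf P M k i = (\<chi> m. Rhat P i $ fnum M k i m)"

definition Nx :: "('k, 'f::finite) mesh \<Rightarrow> 'k \<Rightarrow> 3 \<Rightarrow> real^'f^'f" where
  "Nx M k i = diag (\<chi> m. fst (nrm M k i m))"

definition Ny :: "('k, 'f::finite) mesh \<Rightarrow> 'k \<Rightarrow> 3 \<Rightarrow> real^'f^'f" where
  "Ny M k i = diag (\<chi> m. snd (nrm M k i m))"

definition Ex :: "('n::finite, 'f::finite) sbp_op \<Rightarrow> ('k, 'f) mesh \<Rightarrow> 'k \<Rightarrow> real^'n^'n" where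
  "Ex P M k = (\<Sum>i\<in>UNIV. transpose (Rf P M k i) ** Bf P M k i ** Nx M k i ** Rf P M k i)"

definition Ey :: "('n::finite, 'f::finite) sbp_op \<Rightarrow> ('k, 'f) mesh \<Rightarrow> 'k \<Rightarrow> real^'n^'n" where
  "Ey P M k = (\<Sum>i\<in>UNIV. transpose (Rf P M k i) ** Bf P M k i ** Ny M k i ** Rf P M k i)"

definition Sx :: "('n::finite, 'f::finite) sbp_op \<Rightarrow> ('k, 'f) mesh \<Rightarrow> 'k \<Rightarrow> real^'n^'n" where
  "Sx P M k =
     (let y_xi = diag (at_nodes P (d_xi (snd \<circ> emap M k)));
          y_eta = diag (at_nodes P (d_eta (snd \<circ> emap M k)))
      in (1 / 2) *\<^sub>R (y_eta ** Qxi P - transpose (Qxi P) ** y_eta)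
       + (1 / 2) *\<^sub>R (- (y_xi ** Qeta P) + transpose (Qeta P) ** y_xi))"

definition Sy :: "('n::finite, 'f::finite) sbp_op \<Rightarrow> ('k, 'f) mesh \<Rightarrow> 'k \<Rightarrow> real^'n^'n" where
  "Sy P M k =
     (let x_xi = diag (at_nodes P (d_xi (fst \<circ> emap M k)));
          x_eta = diag (at_nodes P (d_eta (fst \<circ> emap M k)))
      in (1 / 2) *\<^sub>R (- (x_eta ** Qxi P) + transpose (Qxi P) ** x_eta)
       + (1 / 2) *\<^sub>R (x_xi ** Qeta P - transpose (Qeta P) ** x_xi))"

definition Dx :: "('n::finite, 'f::finite) sbp_op \<Rightarrow> ('k, 'f) mesh \<Rightarrow> 'k \<Rightarrow> real^'n^'n" where
  "Dx P M k = matrix_inv (Hk P M k) ** (Sx P M k + (1 / 2) *\<^sub>R Ex P M k)"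

definition Dy :: "('n::finite, 'f::finite) sbp_op \<Rightarrow> ('k, 'f) mesh \<Rightarrow> 'k \<Rightarrow> real^'n^'n" where
  "Dy P M k = matrix_inv (Hk P M k) ** (Sy P M k + (1 / 2) *\<^sub>R Ey P M k)"

text \<open>\<open>Lam P M A k a b\<close> is block \<open>(a, b)\<close> of the tensor matrix; \<open>flux_x\<close> and \<open>flux_y\<close> are the
  two blocks of its product with the stacked matrices \<open>Dx\<close>, \<open>Dy\<close>.\<close>

definition Lam ::
  "('n::finite, 'f::finite) sbp_op \<Rightarrow> ('k, 'f) mesh \<Rightarrow> problem \<Rightarrow> 'k \<Rightarrow> 2 \<Rightarrow> 2 \<Rightarrow> real^'n^'n" where
  "Lam P M A k a b = diag (at_nodes P (\<lambda>z. lam A (emap M k z) $ a $ b))"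

definition flux_x ::
  "('n::finite, 'f::finite) sbp_op \<Rightarrow> ('k, 'f) mesh \<Rightarrow> problem \<Rightarrow> 'k \<Rightarrow> real^'n^'n" where
  "flux_x P M A k = Lam P M A k 1 1 ** Dx P M k + Lam P M A k 1 2 ** Dy P M k"

definition flux_y ::
  "('n::finite, 'f::finite) sbp_op \<Rightarrow> ('k, 'f) mesh \<Rightarrow> problem \<Rightarrow> 'k \<Rightarrow> real^'n^'n" where
  "flux_y P M A k = Lam P M A k 2 1 ** Dx P M k + Lam P M A k 2 2 ** Dy P M k"

definition D2 ::
  "('n::finite, 'f::finite) sbp_op \<Rightarrow> ('k, 'f) mesh \<Rightarrow> problem \<Rightarrow> 'k \<Rightarrow> real^'n^'n" where
  "D2 P M A k = Dx P M k ** flux_x P M A k + Dy P M k ** flux_y P M A k"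

definition Df ::
  "('n::finite, 'f::finite) sbp_op \<Rightarrow> ('k, 'f) mesh \<Rightarrow> problem \<Rightarrow> 'k \<Rightarrow> 3 \<Rightarrow> real^'n^'f" where
  "Df P M A k i = Nx M k i ** Rf P M k i ** flux_x P M A k + Ny M k i ** Rf P M k i ** flux_y P M A k"


section \<open>Discretization\<close>

text \<open>In \<open>T5 k a b\<close> and \<open>T6 k a b\<close>, both \<open>a\<close> and \<open>b\<close> are facets of element \<open>k\<close>.\<close>

record ('k, 'f) penalty =
  T1 :: "'k \<Rightarrow> 3 \<Rightarrow> real^'f^('f::finite)"
  T2 :: "'k \<Rightarrow> 3 \<Rightarrow> real^'f^'f"
  T3 :: "'k \<Rightarrow> 3 \<Rightarrow> real^'f^'f"
  T4 :: "'k \<Rightarrow> 3 \<Rightarrow> real^'f^'f"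
  T5 :: "'k \<Rightarrow> 3 \<Rightarrow> 3 \<Rightarrow> real^'f^'f"
  T6 :: "'k \<Rightarrow> 3 \<Rightarrow> 3 \<Rightarrow> real^'f^'f"
  TD :: "'k \<Rightarrow> 3 \<Rightarrow> real^'f^'f"

definition jump ::
  "('n::finite, 'f::finite) sbp_op \<Rightarrow> ('k, 'f) mesh \<Rightarrow> ('k \<Rightarrow> real^'n) \<Rightarrow> 'k \<Rightarrow> 3 \<Rightarrow> real^'f" where
  "jump P M u k i =
     (let (v, j) = neighbour M k i in Rf P M k i *v u k - Rf P M v j *v u v)"

definition flux_jump ::
  "('n::finite, 'f::finite) sbp_op \<Rightarrow> ('k, 'f) mesh \<Rightarrow> problem \<Rightarrow> ('k \<Rightarrow> real^'n)
     \<Rightarrow> 'k \<Rightarrow> 3 \<Rightarrow> real^'f" where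
  "flux_jump P M A u k i =
     (let (v, j) = neighbour M k i in Df P M A k i *v u k + Df P M A v j *v u v)"

definition sat_interior ::
  "('n::finite, 'f::finite) sbp_op \<Rightarrow> ('k, 'f) mesh \<Rightarrow> problem \<Rightarrow> ('k, 'f) penalty
     \<Rightarrow> ('k \<Rightarrow> real^'n) \<Rightarrow> 'k \<Rightarrow> real^'n" where
  "sat_interior P M A T u k =
     (\<Sum>i | interior_facet M k i.
        transpose (Rf P M k i) *v (T1 T k i *v jump P M u k i + T3 T k i *v flux_jump P M A u k i)
      + transpose (Df P M A k i) *v (T2 T k i *v jump P M u k i + T4 T k i *v flux_jump P M A u k i))
   + (\<Sum>i | interior_facet M k i.
        (\<Sum>e | e \<noteq> i \<and> interior_facet M k e.
            transpose (Rf P M k i) *v (T5 T k i e *v jump P M u k e))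
      + (let (v, j) = neighbour M k i in
          \<Sum>d | d \<noteq> j \<and> interior_facet M v d.
            transpose (Rf P M k i) *v (T6 T v j d *v jump P M u v d)))"

definition dirichlet_data ::
  "('n::finite, 'f::finite) sbp_op \<Rightarrow> ('k, 'f) mesh \<Rightarrow> problem \<Rightarrow> real \<Rightarrow> 'k \<Rightarrow> 3 \<Rightarrow> real^'f" where
  "dirichlet_data P M A t k i = (\<chi> m. dirichlet A t (facet_node P M k i m))"

definition neumann_data ::
  "('n::finite, 'f::finite) sbp_op \<Rightarrow> ('k, 'f) mesh \<Rightarrow> problem \<Rightarrow> real \<Rightarrow> 'k \<Rightarrow> 3 \<Rightarrow> real^'f" where
  "neumann_data P M A t k i = (\<chi> m. neumann A t (facet_node P M k i m))"

definition sat_boundary ::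
  "('n::finite, 'f::finite) sbp_op \<Rightarrow> ('k, 'f) mesh \<Rightarrow> problem \<Rightarrow> ('k, 'f) penalty
     \<Rightarrow> real \<Rightarrow> ('k \<Rightarrow> real^'n) \<Rightarrow> 'k \<Rightarrow> real^'n" where
  "sat_boundary P M A T t u k =
     (\<Sum>i | D_facet M A k i.
        (let e = Rf P M k i *v u k - dirichlet_data P M A t k i in
         transpose (Rf P M k i) *v (TD T k i *v e)
       + transpose (Df P M A k i) *v (- Bf P M k i *v e)))
   + (\<Sum>i | N_facet M A k i.
        transpose (Rf P M k i) *v
          (Bf P M k i *v (Df P M A k i *v u k - neumann_data P M A t k i)))"

text \<open>The time derivative which the scheme prescribes for the state \<open>u\<close> at time \<open>t\<close>.\<close>

definition sbp_sat_rhs ::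
  "('n::finite, 'f::finite) sbp_op \<Rightarrow> ('k, 'f) mesh \<Rightarrow> problem \<Rightarrow> ('k, 'f) penalty
     \<Rightarrow> real \<Rightarrow> ('k \<Rightarrow> real^'n) \<Rightarrow> 'k \<Rightarrow> real^'n" where
  "sbp_sat_rhs P M A T t u k =
     D2 P M A k *v u k + at_nodes P (\<lambda>z. source A t (emap M k z))
     - matrix_inv (Hk P M k) *v sat_interior P M A T u k
     - matrix_inv (Hk P M k) *v sat_boundary P M A T t u k"

definition boundary_terms ::
  "('n::finite, 'f::finite) sbp_op \<Rightarrow> ('k::finite, 'f) mesh \<Rightarrow> problem \<Rightarrow> ('k, 'f) penalty
     \<Rightarrow> real \<Rightarrow> ('k \<Rightarrow> real^'n) \<Rightarrow> real" where
  "boundary_terms P M A T t u =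
     (\<Sum>(k, i) | N_facet M A k i.
        1 \<bullet> (transpose (Rf P M k i) *v (Bf P M k i *v neumann_data P M A t k i)))
   + (\<Sum>(k, i) | D_facet M A k i.
        1 \<bullet> (transpose (Rf P M k i) *v (Bf P M k i *v (Df P M A k i *v u k)))
      - 1 \<bullet> (transpose (Rf P M k i) *v
               (TD T k i *v (Rf P M k i *v u k - dirichlet_data P M A t k i))))"

text \<open>The condition is pointwise in time: it concerns every family \<open>u\<close> that satisfies the
  semi-discrete equations at time \<open>t\<close>, in particular every solution of them on a time interval.\<close>

definition conservative ::
  "('n::finite, 'f::finite) sbp_op \<Rightarrow> ('k::finite, 'f) mesh \<Rightarrow> problem \<Rightarrow> ('k, 'f) penalty \<Rightarrow> bool"
where
  "conservative P M A T \<longleftrightarrow>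
     (\<forall>(u :: 'k \<Rightarrow> real \<Rightarrow> real^'n) t. 0 \<le> t \<and>
        (\<forall>k. (u k has_vector_derivative
                sbp_sat_rhs P M (A\<lparr>source := \<lambda>_ _. 0\<rparr>) T t (\<lambda>l. u l t) k) (at t within {0..}))
        \<longrightarrow> (\<Sum>k\<in>UNIV. 1 \<bullet> (Hk P M k *v vector_derivative (u k) (at t within {0..})))
            = boundary_terms P M A T t (\<lambda>l. u l t))"

end

theory Submission
  imports Defs
begin

text \<open>Testing the scheme with the constant \<open>1\<close> uses two facts about the physical operators:
  \<open>Dx\<close> and \<open>Dy\<close> annihilate constants, and \<open>1\<^sup>T H Dx = 1\<^sup>T Ex\<close>, \<open>1\<^sup>T H Dy = 1\<^sup>T Ey\<close>. Both follow
  from the skew-symmetry of \<open>Sx\<close>, \<open>Sy\<close> and the identity \<open>2 Sx 1 = - Ex 1\<close>, \<open>2 Sy 1 = - Ey 1\<close>. The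
  mapping having degree at most \<open>p + 1\<close>, its metric terms have degree at most \<open>p\<close>, so the reference
  operators differentiate and extrapolate them exactly; equality of mixed partial derivatives
  removes the volume terms, and what remains on the facets is the derivative of the mapping along
  the reference tangent. This agrees with \<open>Ex 1\<close> since the outward normal times the arc length
  factor is the physical tangent turned clockwise.

  It follows that the volume terms reduce to the fluxes \<open>1\<^sup>T B D u\<close> through all facets and that the
  penalties multiplied by the transposed flux operator vanish. Over the two sides of an interior
  facet, the \<open>T1\<close> terms cancel, the \<open>T3\<close> terms add up to the two fluxes, and after renaming the
  sides the \<open>T6\<close> terms cancel the \<open>T5\<close> terms.\<close>

section \<open>Bivariate polynomials\<close>

text \<open>Powers are replaced by arbitrary families \<open>F\<close> and \<open>G\<close> so that
  a partial derivative merely exchanges one family for its derivative; iterated partial derivatives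
  keep this shape.\<close>

definition bipoly ::
  "nat \<Rightarrow> (nat \<Rightarrow> nat \<Rightarrow> real) \<Rightarrow> (nat \<Rightarrow> real \<Rightarrow> real) \<Rightarrow> (nat \<Rightarrow> real \<Rightarrow> real) \<Rightarrow> point \<Rightarrow> real"
where
  "bipoly d c F G = (\<lambda>(x, y). \<Sum>i\<le>d. \<Sum>j\<le>d - i. c i j * F i x * G j y)"

lemma poly2_iff_bipoly:
  "f \<in> poly2 d \<longleftrightarrow> (\<exists>c. f = bipoly d c (\<lambda>i x. x ^ i) (\<lambda>j y. y ^ j))"
  unfolding poly2_def bipoly_def by (auto simp: fun_eq_iff)

lemma d_xi_bipoly:
  assumes "\<And>i x. (F i has_real_derivative F' i x) (at x)"
  shows "d_xi (bipoly d c F G) = bipoly d c F' G"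
  unfolding d_xi_def bipoly_def split
  by (intro ext, clarify, intro DERIV_imp_deriv)
    (auto intro!: derivative_eq_intros assms sum.cong simp: mult_ac)

lemma d_eta_bipoly:
  assumes "\<And>j y. (G j has_real_derivative G' j y) (at y)"
  shows "d_eta (bipoly d c F G) = bipoly d c F G'"
  unfolding d_eta_def bipoly_def split
  by (intro ext, clarify, intro DERIV_imp_deriv)
    (auto intro!: derivative_eq_intros assms sum.cong simp: mult_ac)

lemma has_real_derivative_monomial:
  "((\<lambda>x. x ^ i) has_real_derivative real i * x ^ (i - 1)) (at x)"
  by (auto intro!: derivative_eq_intros)

lemma bipoly_has_derivative:
  assumes F: "\<And>i x. (F i has_real_derivative F' i x) (at x)"
    and G: "\<And>j y. (G j has_real_derivative G' j y) (at y)"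
  shows "(bipoly d c F G has_derivative
          (\<lambda>h. bipoly d c F' G z * fst h + bipoly d c F G' z * snd h)) (at z)"
proof -
  have F1: "((\<lambda>z::point. F i (fst z)) has_derivative (\<lambda>h. fst h * F' i (fst z))) (at z)" for i
    using has_derivative_compose[OF has_derivative_fst[OF has_derivative_ident]
        F[of i "fst z", unfolded has_field_derivative_def]] by (simp add: mult.commute)
  have G1: "((\<lambda>z::point. G j (snd z)) has_derivative (\<lambda>h. snd h * G' j (snd z))) (at z)" for j
    using has_derivative_compose[OF has_derivative_snd[OF has_derivative_ident]
        G[of j "snd z", unfolded has_field_derivative_def]] by (simp add: mult.commute)
  have "((\<lambda>z. c i j * F i (fst z) * G j (snd z)) has_derivative
      (\<lambda>h. c i j * F' i (fst z) * G j (snd z) * fst h + c i j * F i (fst z) * G' j (snd z) * snd h)) (at z)"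
    for i j
    by (rule has_derivative_eq_rhs, rule has_derivative_mult, rule has_derivative_mult,
        rule has_derivative_const, rule F1, rule G1) (simp add: fun_eq_iff algebra_simps)
  then have "((\<lambda>z. \<Sum>i\<le>d. \<Sum>j\<le>d - i. c i j * F i (fst z) * G j (snd z)) has_derivative
      (\<lambda>h. \<Sum>i\<le>d. \<Sum>j\<le>d - i. c i j * F' i (fst z) * G j (snd z) * fst h
        + c i j * F i (fst z) * G' j (snd z) * snd h)) (at z)"
    by (intro has_derivative_sum)
  then show ?thesis
    by (simp add: bipoly_def case_prod_unfold sum.distrib sum_distrib_right)
qed

text \<open>The terms with \<open>i = 0\<close> vanish, and lowering \<open>i\<close> by one keeps
  the bound on \<open>j\<close>, since \<open>Suc d - Suc i = d - i\<close>.\<close>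

lemma d_xi_poly2:
  assumes "f \<in> poly2 (Suc d)"
  shows "d_xi f \<in> poly2 d"
proof -
  obtain c where f: "f = bipoly (Suc d) c (\<lambda>i x. x ^ i) (\<lambda>j y. y ^ j)"
    using assms unfolding poly2_iff_bipoly by blast
  have "d_xi f = bipoly d (\<lambda>i j. c (Suc i) j * real (Suc i)) (\<lambda>i x. x ^ i) (\<lambda>j y. y ^ j)"
    unfolding f d_xi_bipoly[OF has_real_derivative_monomial]
    by (simp add: bipoly_def fun_eq_iff sum.atMost_Suc_shift mult.assoc del: sum.atMost_Suc)
  then show ?thesis
    unfolding poly2_iff_bipoly by blast
qed

lemma d_eta_poly2:
  assumes "f \<in> poly2 (Suc d)"
  shows "d_eta f \<in> poly2 d"
proof -
  obtain c where f: "f = bipoly (Suc d) c (\<lambda>i x. x ^ i) (\<lambda>j y. y ^ j)"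
    using assms unfolding poly2_iff_bipoly by blast
  have shift: "(\<Sum>j\<le>Suc d - i. c i j * x ^ i * (real j * y ^ (j - 1)))
      = (\<Sum>j\<le>d - i. c i (Suc j) * real (Suc j) * x ^ i * y ^ j)" if "i \<le> d" for i and x y :: real
    unfolding Suc_diff_le[OF that]
    by (subst sum.atMost_Suc_shift) (simp add: mult_ac)
  have "d_eta f = bipoly d (\<lambda>i j. c i (Suc j) * real (Suc j)) (\<lambda>i x. x ^ i) (\<lambda>j y. y ^ j)"
    unfolding f d_eta_bipoly[OF has_real_derivative_monomial]
    unfolding bipoly_def fun_eq_iff case_prod_unfold
    \<comment> \<open>The row \<open>i = Suc d\<close>, outside the range of \<open>shift\<close>,
      contains only \<open>j = 0\<close>, where the factor \<open>real j\<close> is zero.\<close>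
    by (subst sum.atMost_Suc) (use shift in \<open>auto intro!: sum.cong\<close>)
  then show ?thesis
    unfolding poly2_iff_bipoly by blast
qed

lemma poly2_mixed_partials:
  assumes "f \<in> poly2 d"
  shows "d_xi (d_eta f) = d_eta (d_xi f)"
  using assms unfolding poly2_iff_bipoly
  by (auto simp: d_xi_bipoly[OF has_real_derivative_monomial]
      d_eta_bipoly[OF has_real_derivative_monomial])

lemma poly2_has_derivative:
  assumes "f \<in> poly2 d"
  shows "(f has_derivative (\<lambda>h. d_xi f z * fst h + d_eta f z * snd h)) (at z)"
proof -
  obtain c where f: "f = bipoly d c (\<lambda>i x. x ^ i) (\<lambda>j y. y ^ j)"
    using assms unfolding poly2_iff_bipoly by blast
  show ?thesis
    unfolding f d_xi_bipoly[OF has_real_derivative_monomial]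
      d_eta_bipoly[OF has_real_derivative_monomial]
    by (rule bipoly_has_derivative[OF has_real_derivative_monomial has_real_derivative_monomial])
qed

lemma const_in_poly2: "(\<lambda>_. c) \<in> poly2 d"
proof -
  have "(\<Sum>i\<le>d. \<Sum>j\<le>d - i. (if i = 0 \<and> j = 0 then c else 0) * x ^ i * y ^ j) = c" for x y :: real
  proof -
    have "(\<Sum>i\<le>d. \<Sum>j\<le>d - i. (if i = 0 \<and> j = 0 then c else 0) * x ^ i * y ^ j)
        = (\<Sum>i\<le>d. \<Sum>j\<le>d - i. if j = 0 then if i = 0 then c else 0 else 0)"
      by (intro sum.cong) auto
    then show ?thesis
      by simp
  qed
  then show ?thesis
    unfolding poly2_def by (auto intro!: exI[of _ "\<lambda>i j. if i = 0 \<and> j = 0 then c else 0"])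
qed

section \<open>Outward normals of mapped facets\<close>

text \<open>With \<open>F = g \<circ> f\<close>, whose derivative at \<open>x\<close> is the identity, Brouwer's theorem on the balls of
  the cone solves \<open>F y = F x + h u\<close>; no regularity beyond differentiability at \<open>x\<close> is needed.\<close>

lemma image_contains_cone_directions:
  fixes f :: "'a::euclidean_space \<Rightarrow> 'a"
  assumes cont: "continuous_on S f"
    and der: "(f has_derivative f') (at x)"
    and g: "bounded_linear g" "\<And>v. g (f' v) = v" "\<And>w. f' (g w) = w"
    and e: "e > 0" "\<forall>\<^sub>F h in at_right 0. cball (x + h *\<^sub>R u) (e * h) \<subseteq> S"
  shows "\<forall>\<^sub>F h in at_right 0. f x + h *\<^sub>R f' u \<in> f ` S"
proof -
  interpret g: bounded_linear g by fact
  define F where "F = g \<circ> f"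
  have F: "(F has_derivative (\<lambda>v. v)) (at x)"
    using has_derivative_compose[OF der bounded_linear_imp_has_derivative[OF g(1)]]
    by (simp add: F_def o_def g(2))
  \<comment> \<open>On the ball, \<open>y\<close> is at distance at most
    \<open>h * (norm u + e)\<close> from \<open>x\<close>; this tolerance makes the deviation of
    \<open>F\<close> from a translation at most the radius \<open>e * h\<close>.\<close>
  define \<epsilon> where "\<epsilon> = e / (norm u + e)"
  have \<epsilon>: "\<epsilon> > 0" "\<epsilon> * (norm u + e) = e"
    using e(1) by (auto simp: \<epsilon>_def add_nonneg_pos) (smt (verit) norm_ge_zero)
  obtain d where d: "d > 0" "\<And>y. norm (y - x) < d \<Longrightarrow> norm (F y - F x - (y - x)) \<le> \<epsilon> * norm (y - x)"
    using F \<epsilon>(1) unfolding has_derivative_at_alt by blast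
  have "norm u + e > 0"
    using e(1) by (simp add: add_nonneg_pos)
  then have "\<forall>\<^sub>F h in at_right 0. h < d / (norm u + e)"
    using eventually_at_right_real[of 0 "d / (norm u + e)"] d(1) by (auto elim!: eventually_mono)
  with e(2) eventually_at_right_less[of "0::real"] show ?thesis
  proof eventually_elim
    case (elim h)
    have near: "norm (y - x) \<le> h * (norm u + e)" if "y \<in> cball (x + h *\<^sub>R u) (e * h)" for y
    proof -
      have "y - x = (y - (x + h *\<^sub>R u)) + h *\<^sub>R u"
        by simp
      also have "norm \<dots> \<le> e * h + h * norm u"
        using that elim(2) by (intro norm_triangle_mono) (auto simp: dist_norm norm_minus_commute)
      finally show ?thesis
        by (simp add: algebra_simps)
    qed
    have "\<exists>y\<in>cball (x + h *\<^sub>R u) (e * h). F y = F x + h *\<^sub>R u"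
    \<comment> \<open>The criterion asks that \<open>y \<mapsto> z + (y - F y)\<close> map the ball
      into itself; the distance of that point from the centre is exactly the linearization error of
      \<open>F\<close> at \<open>y\<close>.\<close>
    proof (rule brouwer_surjective_cball[where S = "{F x + h *\<^sub>R u}"])
      show "continuous_on (cball (x + h *\<^sub>R u) (e * h)) F"
        unfolding F_def using continuous_on_subset[OF cont elim(1)]
        by (intro continuous_on_compose continuous_on_subset[OF g.continuous_on[OF continuous_on_id] subset_UNIV])
      fix z y assume z: "z \<in> {F x + h *\<^sub>R u}" and y: "y \<in> cball (x + h *\<^sub>R u) (e * h)"
      have "norm (y - x) < d"
        using near[OF y] elim(3) e(1) by (smt (verit) mult.commute norm_ge_zero pos_less_divide_eq)
      then have "norm (F y - F x - (y - x)) \<le> \<epsilon> * norm (y - x)"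
        by (rule d(2))
      also have "\<dots> \<le> \<epsilon> * (h * (norm u + e))"
        using \<epsilon>(1) near[OF y] by (intro mult_left_mono) auto
      also have "\<dots> = e * h"
        using \<epsilon>(2) by (metis mult.assoc mult.commute)
      finally show "z + (y - F y) \<in> cball (x + h *\<^sub>R u) (e * h)"
        using z by (simp add: dist_norm algebra_simps)
    qed (use e elim in auto)
    then obtain y where y: "y \<in> S" "F y = F x + h *\<^sub>R u"
      using elim(1) by blast
    have "f y = f' (F x + h *\<^sub>R u)"
      using y(2) g(3) by (metis F_def comp_apply)
    also have "\<dots> = f x + h *\<^sub>R f' u"
      using has_derivative_bounded_linear[OF der]
      by (simp add: F_def g(3) linear_simps)
    finally show ?case
      using y(1) by (metis image_eqI)
  qed
qed

text \<open>The determinant with columns \<open>a\<close> and \<open>b\<close>. For a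
  counterclockwise tangent \<open>a\<close> it is positive when \<open>b\<close> points to the inner
  side.\<close>

definition cross2 :: "point \<Rightarrow> point \<Rightarrow> real" where
  "cross2 a b = fst a * snd b - snd a * fst b"

lemma abs_cross2_le: "\<bar>cross2 a b\<bar> \<le> (\<bar>fst a\<bar> + \<bar>snd a\<bar>) * norm b"
proof -
  have "\<bar>cross2 a b\<bar> \<le> \<bar>fst a\<bar> * \<bar>snd b\<bar> + \<bar>snd a\<bar> * \<bar>fst b\<bar>"
    unfolding cross2_def abs_mult[symmetric] by linarith
  also have "\<dots> \<le> \<bar>fst a\<bar> * norm b + \<bar>snd a\<bar> * norm b"
    using norm_fst_le[of "fst b" "snd b"] norm_snd_le[of "snd b" "fst b"]
    by (intro add_mono mult_left_mono) auto
  finally show ?thesis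
    by (simp add: algebra_simps)
qed

section \<open>Half-planes and inner cones of the reference triangle\<close>

text \<open>The index \<open>4\<close> arises from \<open>3 + 1\<close> on the last facet and is
  vertex \<open>1\<close> modulo 3.\<close>

lemma ref_vertex_simps [simp]:
  "ref_vertex 1 = (-1, -1)" "ref_vertex 2 = (1, -1)" "ref_vertex 3 = (-1, 1)" "ref_vertex 4 = (-1, -1)"
  by (simp_all add: ref_vertex_def)

lemma ref_tangent_simps:
  "ref_tangent 1 = (1, 0)" "ref_tangent 2 = (-1, 1)" "ref_tangent 3 = (0, -1)"
  by (simp_all add: ref_tangent_def)

lemma ref_tangent_nonzero: "ref_tangent i \<noteq> 0"
  using exhaust_3[of i] by (auto simp: ref_tangent_simps zero_prod_def)

text \<open>In this form membership is three conditions affine in the point, which are easy to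
  follow under perturbation.\<close>

lemma ref_triangle_eq_halfplanes:
  "ref_triangle = {z. \<forall>i. cross2 (ref_tangent i) (z - ref_vertex i) \<ge> 0}"
proof -
  have "ref_triangle = {z. -1 \<le> fst z \<and> -1 \<le> snd z \<and> fst z + snd z \<le> 0}" (is "_ = ?S")
  proof
    show "ref_triangle \<subseteq> ?S"
      unfolding ref_triangle_def UNIV_3 by (auto simp: convex_hull_3_alt)
    show "?S \<subseteq> ref_triangle"
    proof
      fix z :: point assume "z \<in> ?S"
      \<comment> \<open>The coefficients are the barycentric coordinates of \<open>z\<close>
        belonging to vertices 2 and 3.\<close>
      then have "z = ref_vertex 1 + ((fst z + 1) / 2) *\<^sub>R (ref_vertex 2 - ref_vertex 1)
          + ((snd z + 1) / 2) *\<^sub>R (ref_vertex 3 - ref_vertex 1)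
          \<and> 0 \<le> (fst z + 1) / 2 \<and> 0 \<le> (snd z + 1) / 2 \<and> (fst z + 1) / 2 + (snd z + 1) / 2 \<le> 1"
        by (auto simp: prod_eq_iff field_simps)
      then show "z \<in> ref_triangle"
        unfolding ref_triangle_def UNIV_3 image_insert image_empty convex_hull_3_alt by blast
    qed
  qed
  also have "\<dots> = {z. \<forall>i. cross2 (ref_tangent i) (z - ref_vertex i) \<ge> 0}"
    by (auto simp: forall_3 cross2_def ref_tangent_simps)
  finally show ?thesis .
qed

text \<open>End points are excluded because a second of the three functions vanishes there; Gauss
  nodes are never end points.\<close>

lemma cross2_ref_facet:
  assumes "-1 < s" "s < 1"
  shows "cross2 (ref_tangent i) (ref_facet i s - ref_vertex i) = 0"
    and "j \<noteq> i \<Longrightarrow> cross2 (ref_tangent j) (ref_facet i s - ref_vertex j) > 0"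
  using assms exhaust_3[of i] exhaust_3[of j]
  by (auto simp: cross2_def ref_tangent_simps ref_facet_def field_simps)

lemma ref_facet_in_ref_triangle:
  assumes "-1 < s" "s < 1"
  shows "ref_facet i s \<in> ref_triangle"
  unfolding ref_triangle_eq_halfplanes using cross2_ref_facet[OF assms]
  by (force simp: less_eq_real_def)

text \<open>Along \<open>u\<close> the constraint of facet \<open>i\<close> grows from 0 at rate
  \<open>2 * e\<close>, while the other two start positive and have slack for small
  \<open>h\<close>. The tangent entries have absolute sum at most 2, so moving by
  \<open>e * h\<close> costs each constraint at most \<open>2 * (e * h)\<close>.\<close>

lemma ref_triangle_cone_at_facet:
  assumes s: "-1 < s" "s < 1" and u: "cross2 (ref_tangent i) u > 0"
  shows "\<exists>e>0. \<forall>\<^sub>F h in at_right 0. cball (ref_facet i s + h *\<^sub>R u) (e * h) \<subseteq> ref_triangle"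
proof -
  define e where "e = cross2 (ref_tangent i) u / 2"
  have e: "e > 0"
    using u by (simp add: e_def)
  let ?b = "\<lambda>j. cross2 (ref_tangent j) (ref_facet i s - ref_vertex j)"
  have nonneg: "\<forall>\<^sub>F h in at_right 0. 0 \<le> ?b j + h * cross2 (ref_tangent j) u - 2 * (e * h)" for j
  proof (cases "j = i")
    case True
    then show ?thesis
      by (simp add: cross2_ref_facet(1)[OF s] e_def)
  next
    case False
    have "((\<lambda>h. ?b j + h * cross2 (ref_tangent j) u - 2 * (e * h)) \<longlongrightarrow> ?b j) (at_right 0)"
      by (auto intro!: tendsto_eq_intros)
    from order_tendstoD(1)[OF this cross2_ref_facet(2)[OF s False]] show ?thesis
      by eventually_elim simp
  qed
  have "\<forall>\<^sub>F h in at_right 0. \<forall>j. 0 \<le> ?b j + h * cross2 (ref_tangent j) u - 2 * (e * h)"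
    using nonneg by (intro eventually_all_finite) auto
  then have "\<forall>\<^sub>F h in at_right 0. cball (ref_facet i s + h *\<^sub>R u) (e * h) \<subseteq> ref_triangle"
  proof eventually_elim
    case (elim h)
    show ?case
    proof
      fix z assume z: "z \<in> cball (ref_facet i s + h *\<^sub>R u) (e * h)"
      define w where "w = z - (ref_facet i s + h *\<^sub>R u)"
      have w: "norm w \<le> e * h"
        using z by (simp add: w_def dist_norm norm_minus_commute)
      have "0 \<le> cross2 (ref_tangent j) (z - ref_vertex j)" for j
      proof -
        have "\<bar>fst (ref_tangent j)\<bar> + \<bar>snd (ref_tangent j)\<bar> \<le> 2"
          using exhaust_3[of j] by (auto simp: ref_tangent_simps)
        then have "\<bar>cross2 (ref_tangent j) w\<bar> \<le> 2 * (e * h)"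
          using abs_cross2_le[of "ref_tangent j" w] w mult_mono[OF _ w, of _ 2]
          by (smt (verit) norm_ge_zero)
        moreover have "cross2 (ref_tangent j) (z - ref_vertex j)
            = ?b j + h * cross2 (ref_tangent j) u + cross2 (ref_tangent j) w"
          by (simp add: w_def cross2_def algebra_simps)
        ultimately show ?thesis
          using elim[rule_format, of j] by linarith
      qed
      then show "z \<in> ref_triangle"
        by (simp add: ref_triangle_eq_halfplanes)
    qed
  qed
  with e show ?thesis
    by blast
qed

section \<open>Tangents and normals through the chain rule\<close>

text \<open>The derivative of \<open>f\<close> along \<open>ref_facet i\<close> with respect to the
  parameter on \<open>[-1, 1]\<close>, not to arc length.\<close>

definition tangential_deriv :: "(point \<Rightarrow> real) \<Rightarrow> 3 \<Rightarrow> real \<Rightarrow> real" where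
  "tangential_deriv f i s =
     d_xi f (ref_facet i s) * fst (ref_tangent i) + d_eta f (ref_facet i s) * snd (ref_tangent i)"

lemma poly2_map_has_derivative:
  assumes "fst \<circ> \<phi> \<in> poly2 d" "snd \<circ> \<phi> \<in> poly2 d"
  shows "(\<phi> has_derivative (\<lambda>h. (d_xi (fst \<circ> \<phi>) z * fst h + d_eta (fst \<circ> \<phi>) z * snd h,
                                 d_xi (snd \<circ> \<phi>) z * fst h + d_eta (snd \<circ> \<phi>) z * snd h))) (at z)"
  using has_derivative_Pair[OF assms[THEN poly2_has_derivative]] by simp

lemma facet_tangent_poly2:
  assumes "fst \<circ> \<phi> \<in> poly2 d" "snd \<circ> \<phi> \<in> poly2 d"
  shows "facet_tangent \<phi> i s = (tangential_deriv (fst \<circ> \<phi>) i s, tangential_deriv (snd \<circ> \<phi>) i s)"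
proof -
  have "(ref_facet i has_vector_derivative ref_tangent i) (at s)"
    unfolding ref_facet_def ref_tangent_def
    by (auto intro!: derivative_eq_intros simp: algebra_simps scaleR_2[symmetric])
  then have "(ref_facet i has_derivative (\<lambda>h. h *\<^sub>R ref_tangent i)) (at s)"
    by (simp add: has_vector_derivative_def)
  from has_derivative_compose[OF this poly2_map_has_derivative[OF assms]]
  have "((\<lambda>t. \<phi> (ref_facet i t)) has_vector_derivative
      (tangential_deriv (fst \<circ> \<phi>) i s, tangential_deriv (snd \<circ> \<phi>) i s)) (at s)"
    unfolding has_vector_derivative_def
    by (rule has_derivative_eq_rhs) (simp add: tangential_deriv_def fun_eq_iff algebra_simps)
  then show ?thesis
    unfolding facet_tangent_def by (rule vector_derivative_at)
qed

text \<open>Unit length and orthogonality to the tangent leave two candidates, and the one obtained by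
  turning the tangent counterclockwise points into the element because the Jacobian is positive.\<close>

lemma outward_unit_normal_poly2:
  assumes \<phi>: "fst \<circ> \<phi> \<in> poly2 d" "snd \<circ> \<phi> \<in> poly2 d"
    and s: "-1 < s" "s < 1"
    and J: "jacobian \<phi> (ref_facet i s) > 0"
    and \<nu>: "outward_unit_normal \<phi> i s \<nu>"
  shows "norm (facet_tangent \<phi> i s) * fst \<nu> = tangential_deriv (snd \<circ> \<phi>) i s"
    and "norm (facet_tangent \<phi> i s) * snd \<nu> = - tangential_deriv (fst \<circ> \<phi>) i s"
proof -
  define x where "x = ref_facet i s"
  define \<tau> where "\<tau> = ref_tangent i"
  define a b c e where "a = d_xi (fst \<circ> \<phi>) x" and "b = d_eta (fst \<circ> \<phi>) x"
    and "c = d_xi (snd \<circ> \<phi>) x" and "e = d_eta (snd \<circ> \<phi>) x"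
  define f where "f h = (a * fst h + b * snd h, c * fst h + e * snd h)" for h :: point
  define J where "J = a * e - b * c"
  \<comment> \<open>The inverse of the linear map \<open>f\<close> by Cramer's rule.\<close>
  define g where "g h = ((e * fst h - b * snd h) / J, (a * snd h - c * fst h) / J)" for h :: point
  define t where "t = facet_tangent \<phi> i s"
  have t: "t = f \<tau>" "t = (tangential_deriv (fst \<circ> \<phi>) i s, tangential_deriv (snd \<circ> \<phi>) i s)"
    using facet_tangent_poly2[OF \<phi>, of i s]
    by (simp_all add: f_def t_def \<tau>_def a_def b_def c_def e_def x_def tangential_deriv_def)
  have Jpos: "J > 0"
    using J by (simp add: J_def a_def b_def c_def e_def x_def jacobian_def)
  have gf: "g (f h) = h" for h
  proof -
    have "(e * (a * fst h + b * snd h) - b * (c * fst h + e * snd h)) = J * fst h"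
      "(a * (c * fst h + e * snd h) - c * (a * fst h + b * snd h)) = J * snd h"
      by (simp_all add: J_def algebra_simps)
    then show ?thesis
      using Jpos by (simp add: g_def f_def prod_eq_iff)
  qed
  have fg: "f (g h) = h" for h
  proof -
    have "(a * (e * fst h - b * snd h) + b * (a * snd h - c * fst h)) = J * fst h"
      "(c * (e * fst h - b * snd h) + e * (a * snd h - c * fst h)) = J * snd h"
      by (simp_all add: J_def algebra_simps)
    then show ?thesis
      using Jpos by (simp add: g_def f_def prod_eq_iff add_divide_distrib[symmetric])
  qed
  have g: "bounded_linear g"
    unfolding linear_conv_bounded_linear[symmetric] g_def
    by (rule linearI) (auto simp: algebra_simps add_divide_distrib diff_divide_distrib)
  have unit: "fst \<nu> * fst \<nu> + snd \<nu> * snd \<nu> = 1"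
    using \<nu> by (simp add: outward_unit_normal_def norm_eq_1 inner_prod_def)
  have orth: "fst \<nu> * fst t + snd \<nu> * snd t = 0"
    using \<nu> by (simp add: outward_unit_normal_def inner_prod_def t_def)
  \<comment> \<open>Being orthogonal to the unit vector \<open>\<nu>\<close>, the tangent
    \<open>t\<close> is \<open>\<nu>\<close> turned counterclockwise and scaled by
    \<open>cross2 \<nu> t\<close>. Only the sign of this factor remains open.\<close>
  have \<nu>t: "cross2 \<nu> t * fst \<nu> = snd t" "cross2 \<nu> t * snd \<nu> = - fst t"
    using unit orth unfolding cross2_def by algebra+
  have sq: "(cross2 \<nu> t)\<^sup>2 = (norm t)\<^sup>2"
    using unit orth unfolding cross2_def power2_norm_eq_inner inner_prod_def by simp algebra
  have "\<not> cross2 \<nu> t < 0"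
  proof
    assume neg: "cross2 \<nu> t < 0"
    \<comment> \<open>Determinants multiply under \<open>f\<close>, so positivity of
      \<open>J\<close> transfers orientation back to the reference triangle: \<open>g \<nu>\<close>
      would point inwards there, and its image \<open>\<nu>\<close> would enter the element.\<close>
    have "J * cross2 \<tau> (g \<nu>) = cross2 (f \<tau>) (f (g \<nu>))"
      by (simp add: J_def f_def cross2_def algebra_simps)
    also have "\<dots> = - cross2 \<nu> t"
      by (simp add: fg t(1)) (simp add: cross2_def)
    finally have "J * cross2 \<tau> (g \<nu>) > 0"
      using neg by simp
    then have "cross2 \<tau> (g \<nu>) > 0"
      using Jpos by (simp add: zero_less_mult_iff)
    then obtain r where r: "r > 0"
      "\<forall>\<^sub>F h in at_right 0. cball (x + h *\<^sub>R g \<nu>) (r * h) \<subseteq> ref_triangle"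
      using ref_triangle_cone_at_facet[OF s, of i] unfolding \<tau>_def x_def by blast
    have der: "(\<phi> has_derivative f) (at x)"
      using poly2_map_has_derivative[OF \<phi>, of x] unfolding f_def a_def b_def c_def e_def by simp
    have "continuous_on ref_triangle \<phi>"
      using poly2_map_has_derivative[OF \<phi>]
      by (meson continuous_at_imp_continuous_on has_derivative_continuous)
    from image_contains_cone_directions[OF this der g gf fg r]
    have "\<forall>\<^sub>F h in at_right 0. \<phi> x + h *\<^sub>R \<nu> \<in> \<phi> ` ref_triangle"
      by (simp add: fg)
    moreover have "\<forall>\<^sub>F h in at_right 0. \<phi> x + h *\<^sub>R \<nu> \<notin> \<phi> ` ref_triangle"
      using \<nu> by (simp add: outward_unit_normal_def x_def)
    ultimately have "\<forall>\<^sub>F h in at_right (0::real). False"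
      by eventually_elim simp
    then show False
      by simp
  qed
  then have "cross2 \<nu> t = norm t"
    using sq by (simp add: power2_eq_iff_nonneg)
  then show "norm (facet_tangent \<phi> i s) * fst \<nu> = tangential_deriv (snd \<circ> \<phi>) i s"
    and "norm (facet_tangent \<phi> i s) * snd \<nu> = - tangential_deriv (fst \<circ> \<phi>) i s"
    using \<nu>t t(2) unfolding t_def[symmetric] by auto
qed

section \<open>Physical operators applied to constants\<close>

declare transpose_matrix_vector [simp del]

text \<open>Moves a matrix across an inner product. The form \<open>transpose A *v x\<close> is kept
  throughout, so its default rewriting into \<open>x v* A\<close> is switched off.\<close>

lemma inner_matrix_vector_mult:
  fixes A :: "real^'n^'m"
  shows "x \<bullet> (A *v y) = (transpose A *v x) \<bullet> y"
  by (simp add: dot_lmul_matrix[symmetric] transpose_matrix_vector)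

lemma transpose_linear:
  fixes A B :: "real^'n^'m"
  shows "transpose (A + B) = transpose A + transpose B"
    and "transpose (A - B) = transpose A - transpose B"
    and "transpose (- A) = - transpose A"
    and "transpose (c *\<^sub>R A) = c *\<^sub>R transpose A"
  by (simp_all add: transpose_def vec_eq_iff)

lemma transpose_sum:
  fixes A :: "'i \<Rightarrow> real^'n^'m"
  shows "transpose (\<Sum>i\<in>I. A i) = (\<Sum>i\<in>I. transpose (A i))"
  by (simp add: transpose_def vec_eq_iff)

lemma uminus_matrix_vector_mult:
  fixes A :: "real^'n^'m"
  shows "(- A) *v x = - (A *v x)"
  by (simp add: matrix_vector_mult_def vec_eq_iff sum_negf)

lemma matrix_vector_mult_uminus:
  fixes A :: "real^'n^'m"
  shows "A *v (- x) = - (A *v x)"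
  by (simp add: matrix_vector_mult_def vec_eq_iff sum_negf)

lemma sum_matrix_vector_mult:
  fixes A :: "'i \<Rightarrow> real^'n^'m"
  shows "(\<Sum>i\<in>I. A i) *v x = (\<Sum>i\<in>I. A i *v x)"
  by (induction I rule: infinite_finite_induct) (auto simp: matrix_vector_mult_add_rdistrib)

lemma diag_vector_mult: "diag v *v w = v * w"
  by (simp add: diag_def matrix_vector_mult_def vec_eq_iff mult_delta_left)

lemma transpose_diag: "transpose (diag v) = diag v"
  by (auto simp: transpose_def diag_def vec_eq_iff)

lemma diag_mult_diag: "diag v ** diag w = diag (v * w)"
  by (simp add: matrix_eq matrix_vector_mul_assoc[symmetric] diag_vector_mult mult.assoc)

lemma diag_mult_matrix_inv:
  assumes "\<And>i. v $ i \<noteq> 0"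
  shows "diag v ** matrix_inv (diag v) = mat 1" "matrix_inv (diag v) ** diag v = mat 1"
proof -
  define w :: "real^'a" where "w = (\<chi> i. inverse (v $ i))"
  have "v * w = 1"
    using assms by (simp add: w_def vec_eq_iff)
  then have "diag v ** diag w = mat 1" "diag w ** diag v = mat 1"
    by (simp_all add: diag_mult_diag mult.commute) (simp_all add: diag_def mat_def vec_eq_iff)
  then have "\<exists>A'. diag v ** A' = mat 1 \<and> A' ** diag v = mat 1"
    by blast
  \<comment> \<open>\<open>matrix_inv\<close> is defined by choice, so exhibiting one two-sided
    inverse settles both equations.\<close>
  from someI_ex[OF this] show "diag v ** matrix_inv (diag v) = mat 1"
    "matrix_inv (diag v) ** diag v = mat 1"
    unfolding matrix_inv_def by auto
qed

lemma spd_diagD: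
  assumes "spd (diag v)"
  shows "v $ i > 0"
proof -
  have "axis i 1 \<bullet> (diag v *v axis i 1) > 0"
    using assms by (simp add: spd_def axis_eq_0_iff)
  then show ?thesis
    by (simp add: diag_vector_mult inner_axis')
qed

text \<open>Transposition only swaps the two diagonal factors, which commute. All boundary matrices
  have this shape.\<close>

lemma transpose_congruence_diag:
  fixes R :: "real^'n^'f"
  shows "transpose (transpose R ** diag v ** diag w ** R) = transpose R ** diag v ** diag w ** R"
  by (simp add: matrix_transpose_mul transpose_diag matrix_mul_assoc[symmetric])
    (simp add: matrix_mul_assoc diag_mult_diag mult.commute)

text \<open>The transpose of the sum is \<open>- S + (1 / 2) *\<^sub>R E\<close>. At
  \<open>e\<close> the two parts cancel in the sum itself and add up to \<open>E *v e\<close> in its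
  transpose. This is summation by parts against \<open>e\<close>.\<close>

lemma skew_plus_half_symmetric:
  fixes S E :: "real^'n^'n"
  assumes S: "transpose S = - S" and E: "transpose E = E" and SE: "S *v e = - (1 / 2) *\<^sub>R (E *v e)"
  shows "(S + (1 / 2) *\<^sub>R E) *v e = 0"
    and "e \<bullet> ((S + (1 / 2) *\<^sub>R E) *v w) = e \<bullet> (E *v w)"
proof -
  show "(S + (1 / 2) *\<^sub>R E) *v e = 0"
    by (simp add: matrix_vector_mult_add_rdistrib SE scaleR_matrix_vector_assoc[symmetric])
  have "transpose (S + (1 / 2) *\<^sub>R E) *v e = - (S *v e) + (1 / 2) *\<^sub>R (E *v e)"
    by (simp only: transpose_linear S E matrix_vector_mult_add_rdistrib uminus_matrix_vector_mult
        scaleR_matrix_vector_assoc)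
  also have "\<dots> = E *v e"
    by (simp add: SE vec_eq_iff)
  finally have "transpose (S + (1 / 2) *\<^sub>R E) *v e = E *v e" .
  then show "e \<bullet> ((S + (1 / 2) *\<^sub>R E) *v w) = e \<bullet> (E *v w)"
    by (simp add: inner_matrix_vector_mult[of e] E)
qed

section \<open>Reference operators on polynomial data\<close>

lemma sbp_operator_Hhat_pos: "sbp_operator p P \<Longrightarrow> Hhat P $ a > 0"
  unfolding sbp_operator_def by (blast intro: spd_diagD)

lemma transpose_Exi: "transpose (Exi P) = Exi P" and transpose_Eeta: "transpose (Eeta P) = Eeta P"
  by (simp_all add: Exi_def Eeta_def transpose_sum transpose_congruence_diag)

lemma transpose_Qxi_Qeta:
  assumes "sbp_operator p P"
  shows "transpose (Qxi P) = Exi P - Qxi P" "transpose (Qeta P) = Eeta P - Qeta P"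
  using assms by (simp_all add: sbp_operator_def Qxi_def Qeta_def transpose_linear transpose_Exi
      transpose_Eeta vec_eq_iff)

lemma Qxi_Qeta_at_nodes:
  assumes P: "sbp_operator p P" and f: "f \<in> poly2 p"
  shows "Qxi P *v at_nodes P f = Hhat P * at_nodes P (d_xi f)"
    and "Qeta P *v at_nodes P f = Hhat P * at_nodes P (d_eta f)"
proof -
  have "Hhat P $ a \<noteq> 0" for a
    using sbp_operator_Hhat_pos[OF P, of a] by simp
  note H = diag_mult_matrix_inv(1)[OF this]
  have "diag (Hhat P) ** Dxi P = Qxi P" "diag (Hhat P) ** Deta P = Qeta P"
    by (simp_all add: Dxi_def Deta_def matrix_mul_assoc H)
  moreover have "Dxi P *v at_nodes P f = at_nodes P (d_xi f)" "Deta P *v at_nodes P f = at_nodes P (d_eta f)"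
    using P f by (auto simp: sbp_operator_def)
  ultimately show "Qxi P *v at_nodes P f = Hhat P * at_nodes P (d_xi f)"
    and "Qeta P *v at_nodes P f = Hhat P * at_nodes P (d_eta f)"
    by (metis diag_vector_mult matrix_vector_mul_assoc)+
qed

lemma at_nodes_one: "at_nodes P (\<lambda>_. 1) = 1"
  by (simp add: at_nodes_def vec_eq_iff)

lemma Qxi_Qeta_one:
  assumes "sbp_operator p P"
  shows "Qxi P *v 1 = 0" "Qeta P *v 1 = 0"
  using Qxi_Qeta_at_nodes[OF assms const_in_poly2[of 1]]
  by (simp_all add: at_nodes_one) (simp_all add: at_nodes_def d_xi_def d_eta_def vec_eq_iff split_beta)

lemma Rhat_at_nodes:
  assumes "sbp_operator p P" "f \<in> poly2 p"
  shows "Rhat P i *v at_nodes P f = (\<chi> m. f (ref_facet i (gs P m)))"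
  using assms unfolding sbp_operator_def by blast

text \<open>The skew-symmetric part of \<open>diag f_eta ** Qxi - diag f_xi ** Qeta\<close>, where
  \<open>f_xi\<close> and \<open>f_eta\<close> stand for the nodal partial derivatives of
  \<open>f\<close>. It gives \<open>Sx\<close> for the second mapping component and
  \<open>- Sy\<close> for the first, so one computation serves both.\<close>

definition metric_matrix :: "('n::finite, 'f::finite) sbp_op \<Rightarrow> (point \<Rightarrow> real) \<Rightarrow> real^'n^'n" where
  "metric_matrix P f =
     (1 / 2) *\<^sub>R (diag (at_nodes P (d_eta f)) ** Qxi P - transpose (Qxi P) ** diag (at_nodes P (d_eta f)))
   + (1 / 2) *\<^sub>R (- (diag (at_nodes P (d_xi f)) ** Qeta P) + transpose (Qeta P) ** diag (at_nodes P (d_xi f)))"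

lemma Sx_eq_metric_matrix: "Sx P M k = metric_matrix P (snd \<circ> emap M k)"
  by (simp add: Sx_def metric_matrix_def Let_def)

lemma Sy_eq_metric_matrix: "Sy P M k = - metric_matrix P (fst \<circ> emap M k)"
  by (simp add: Sy_def metric_matrix_def Let_def algebra_simps)

lemma transpose_metric_matrix: "transpose (metric_matrix P f) = - metric_matrix P f"
  by (simp add: metric_matrix_def transpose_linear matrix_transpose_mul transpose_transpose
      transpose_diag algebra_simps)

lemma metric_matrix_one:
  assumes P: "sbp_operator p P" and f: "f \<in> poly2 (Suc p)"
  shows "metric_matrix P f *v 1 = - (1 / 2) *\<^sub>R
    (\<Sum>i\<in>UNIV. transpose (Rhat P i) *v (\<chi> m. gw P m * tangential_deriv f i (gs P m)))"
proof -
  let ?x = "at_nodes P (d_xi f)" and ?e = "at_nodes P (d_eta f)"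
  have "metric_matrix P f *v 1
      = (1 / 2) *\<^sub>R (- (transpose (Qxi P) *v ?e)) + (1 / 2) *\<^sub>R (transpose (Qeta P) *v ?x)"
    unfolding metric_matrix_def
    by (simp add: matrix_vector_mult_add_rdistrib matrix_vector_mult_diff_rdistrib
        uminus_matrix_vector_mult scaleR_matrix_vector_assoc[symmetric]
        matrix_vector_mul_assoc[symmetric] Qxi_Qeta_one[OF P] diag_vector_mult)
  \<comment> \<open>The transposes are \<open>Exi - Qxi\<close> and \<open>Eeta - Qeta\<close>. As
    the partial derivatives have degree at most \<open>p\<close>, the \<open>Q\<close> parts yield
    \<open>Hhat\<close> times the two mixed partials, which cancel.\<close>
  also have "\<dots> = - (1 / 2) *\<^sub>R (Exi P *v ?e - Eeta P *v ?x)"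
    using d_xi_poly2[OF f] d_eta_poly2[OF f]
    by (simp add: transpose_Qxi_Qeta[OF P] matrix_vector_mult_diff_rdistrib Qxi_Qeta_at_nodes[OF P]
        poly2_mixed_partials[OF f]) (simp add: algebra_simps)
  also have "Exi P *v ?e - Eeta P *v ?x
      = (\<Sum>i\<in>UNIV. transpose (Rhat P i) *v (\<chi> m. gw P m * tangential_deriv f i (gs P m)))"
  proof -
    \<comment> \<open>The tangent length in \<open>bhat\<close> cancels the normalization of
      \<open>ref_normal\<close>, leaving the tangent turned clockwise; the two products then combine
      into the tangential derivative.\<close>
    have "bhat P i * ((\<chi> m. fst (ref_normal i)) * (Rhat P i *v ?e))
        - bhat P i * ((\<chi> m. snd (ref_normal i)) * (Rhat P i *v ?x))
        = (\<chi> m. gw P m * tangential_deriv f i (gs P m))" for i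
      using ref_tangent_nonzero[of i]
      by (simp add: Rhat_at_nodes[OF P d_xi_poly2[OF f]] Rhat_at_nodes[OF P d_eta_poly2[OF f]]
          vec_eq_iff bhat_def ref_normal_def tangential_deriv_def field_simps)
    then show ?thesis
      unfolding Exi_def Eeta_def sum_matrix_vector_mult sum_subtractf[symmetric]
      by (simp add: matrix_vector_mul_assoc[symmetric] diag_vector_mult
          matrix_vector_mult_diff_distrib[symmetric])
  qed
  finally show ?thesis .
qed

section \<open>Facet and volume operators of a mapped element\<close>

text \<open>Each component is a sum over the facet nodes, and a bijective renumbering permutes its
  summands. This returns mesh data to the reference numbering.\<close>

lemma transpose_Rf_mult:
  fixes P :: "('n::finite, 'f::finite) sbp_op"
  assumes "bij (fnum M k i)"
  shows "transpose (Rf P M k i) *v (\<chi> m. g (fnum M k i m)) = transpose (Rhat P i) *v (\<chi> m. g m)"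
  using sum.reindex_bij_betw[OF assms, of "\<lambda>m. Rhat P i $ m $ a * g m" for a]
  by (simp add: Rf_def transpose_def matrix_vector_mult_def vec_eq_iff)

lemma Rf_one:
  assumes "sbp_operator p P"
  shows "Rf P M k i *v 1 = 1"
  using Rhat_at_nodes[OF assms const_in_poly2[of 1], of i]
  by (simp add: at_nodes_one) (simp add: Rf_def matrix_vector_mult_def vec_eq_iff)

lemma transpose_Ex: "transpose (Ex P M k) = Ex P M k" and transpose_Ey: "transpose (Ey P M k) = Ey P M k"
  using transpose_congruence_diag[of "Rf P M k i" "Jf P M k i * (\<chi> m. bhat P i $ fnum M k i m)" for i]
  by (simp_all add: Ex_def Ey_def Bf_def Nx_def Ny_def transpose_sum diag_mult_diag)

lemma legendre_gauss_node:
  assumes "sbp_operator p P"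
  shows "-1 < gs P m" "gs P m < 1"
  using assms by (auto simp: sbp_operator_def legendre_gauss_def)

lemma conforming_mesh_emap:
  assumes "conforming_mesh p P A M"
  shows "fst \<circ> emap M k \<in> poly2 (Suc p)" "snd \<circ> emap M k \<in> poly2 (Suc p)"
    and "z \<in> ref_triangle \<Longrightarrow> jacobian (emap M k) z > 0"
  using assms by (auto simp: conforming_mesh_def)

lemma norm_facet_tangent_nrm:
  assumes P: "sbp_operator p P" and M: "conforming_mesh p P A M"
  shows "norm (facet_tangent (emap M k) i (gs P (fnum M k i m))) * fst (nrm M k i m)
      = tangential_deriv (snd \<circ> emap M k) i (gs P (fnum M k i m))"
    and "norm (facet_tangent (emap M k) i (gs P (fnum M k i m))) * snd (nrm M k i m)
      = - tangential_deriv (fst \<circ> emap M k) i (gs P (fnum M k i m))"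
proof -
  have "outward_unit_normal (emap M k) i (gs P (fnum M k i m)) (nrm M k i m)"
    using M by (simp add: conforming_mesh_def)
  note * = outward_unit_normal_poly2[OF conforming_mesh_emap(1,2)[OF M] legendre_gauss_node[OF P]
      conforming_mesh_emap(3)[OF M ref_facet_in_ref_triangle[OF legendre_gauss_node[OF P]]] this]
  show "norm (facet_tangent (emap M k) i (gs P (fnum M k i m))) * fst (nrm M k i m)
      = tangential_deriv (snd \<circ> emap M k) i (gs P (fnum M k i m))"
    and "norm (facet_tangent (emap M k) i (gs P (fnum M k i m))) * snd (nrm M k i m)
      = - tangential_deriv (fst \<circ> emap M k) i (gs P (fnum M k i m))"
    by (fact *)+
qed

text \<open>These are, up to sign, the facet sums of \<open>metric_matrix_one\<close>, which ties
  \<open>Sx\<close> to \<open>Ex\<close> and \<open>Sy\<close> to \<open>Ey\<close> on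
  constants.\<close>

lemma Ex_Ey_one:
  assumes P: "sbp_operator p P" and M: "conforming_mesh p P A M"
  shows "Ex P M k *v 1 = (\<Sum>i\<in>UNIV. transpose (Rhat P i) *v
      (\<chi> m. gw P m * tangential_deriv (snd \<circ> emap M k) i (gs P m)))"
    and "Ey P M k *v 1 = - (\<Sum>i\<in>UNIV. transpose (Rhat P i) *v
      (\<chi> m. gw P m * tangential_deriv (fst \<circ> emap M k) i (gs P m)))"
proof -
  have bij: "bij (fnum M k i)" for i
    using M by (simp add: conforming_mesh_def)
  have tang: "tangential_deriv (snd \<circ> emap M k) i (gs P (fnum M k i m))
      = norm (facet_tangent (emap M k) i (gs P (fnum M k i m))) * fst (nrm M k i m)"
    "tangential_deriv (fst \<circ> emap M k) i (gs P (fnum M k i m))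
      = - (norm (facet_tangent (emap M k) i (gs P (fnum M k i m))) * snd (nrm M k i m))" for i m
    using norm_facet_tangent_nrm[OF P M, of k i m] by simp_all
  \<comment> \<open>The reference length in \<open>bhat\<close> cancels the denominator of
    \<open>Jf\<close>, so the physical tangent length multiplies the unit normal.\<close>
  have "Bf P M k i *v (Nx M k i *v 1)
      = (\<chi> m. gw P (fnum M k i m) * tangential_deriv (snd \<circ> emap M k) i (gs P (fnum M k i m)))"
    and "Bf P M k i *v (Ny M k i *v 1)
      = (\<chi> m. - (gw P (fnum M k i m) * tangential_deriv (fst \<circ> emap M k) i (gs P (fnum M k i m))))" for i
    using ref_tangent_nonzero[of i] tang
    by (simp_all add: Bf_def Nx_def Ny_def diag_mult_diag diag_vector_mult vec_eq_iff Jf_def bhat_def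
        ac_simps)
  note BN = this
  show "Ex P M k *v 1 = (\<Sum>i\<in>UNIV. transpose (Rhat P i) *v
      (\<chi> m. gw P m * tangential_deriv (snd \<circ> emap M k) i (gs P m)))"
    unfolding Ex_def sum_matrix_vector_mult
    by (simp add: matrix_vector_mul_assoc[symmetric] Rf_one[OF P] BN
        transpose_Rf_mult[OF bij, where g = "\<lambda>m. gw P m * tangential_deriv (snd \<circ> emap M k) i (gs P m)" for i])
  show "Ey P M k *v 1 = - (\<Sum>i\<in>UNIV. transpose (Rhat P i) *v
      (\<chi> m. gw P m * tangential_deriv (fst \<circ> emap M k) i (gs P m)))"
    unfolding Ey_def sum_matrix_vector_mult sum_negf[symmetric]
    by (simp add: matrix_vector_mul_assoc[symmetric] Rf_one[OF P] BN
        transpose_Rf_mult[OF bij, where g = "\<lambda>m. - (gw P m * tangential_deriv (fst \<circ> emap M k) i (gs P m))" for i])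
      (simp add: matrix_vector_mult_def sum_negf vec_eq_iff)
qed

lemma Hk_mult_matrix_inv:
  assumes P: "sbp_operator p P" and M: "conforming_mesh p P A M"
  shows "Hk P M k *v (matrix_inv (Hk P M k) *v w) = w"
proof -
  have "jacobian (emap M k) (node P a) > 0" for a
    using P M by (simp add: sbp_operator_def conforming_mesh_def)
  then have "((\<chi> a. \<bar>jacobian (emap M k) (node P a)\<bar>) * Hhat P) $ a \<noteq> 0" for a
    using sbp_operator_Hhat_pos[OF P, of a] by (simp add: less_imp_neq[symmetric])
  from diag_mult_matrix_inv(1)[OF this] show ?thesis
    by (simp add: Hk_def diag_mult_diag matrix_vector_mul_assoc)
qed

text \<open>The last two equations are the discrete divergence theorem on one element.\<close>

lemma Dx_Dy_conservation:
  assumes P: "sbp_operator p P" and M: "conforming_mesh p P A M"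
  shows "Dx P M k *v 1 = 0" "Dy P M k *v 1 = 0"
    and "1 \<bullet> (Hk P M k *v (Dx P M k *v w)) = 1 \<bullet> (Ex P M k *v w)"
    and "1 \<bullet> (Hk P M k *v (Dy P M k *v w)) = 1 \<bullet> (Ey P M k *v w)"
proof -
  have S: "transpose (Sx P M k) = - Sx P M k" "transpose (Sy P M k) = - Sy P M k"
    by (simp_all add: Sx_eq_metric_matrix Sy_eq_metric_matrix transpose_linear transpose_metric_matrix)
  have S1: "Sx P M k *v 1 = - (1 / 2) *\<^sub>R (Ex P M k *v 1)" "Sy P M k *v 1 = - (1 / 2) *\<^sub>R (Ey P M k *v 1)"
    by (simp_all add: Sx_eq_metric_matrix Sy_eq_metric_matrix uminus_matrix_vector_mult
        metric_matrix_one[OF P] conforming_mesh_emap(1,2)[OF M] Ex_Ey_one[OF P M])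
  note x = skew_plus_half_symmetric[OF S(1) transpose_Ex S1(1)]
  note y = skew_plus_half_symmetric[OF S(2) transpose_Ey S1(2)]
  show "Dx P M k *v 1 = 0" "Dy P M k *v 1 = 0"
    by (simp_all add: Dx_def Dy_def matrix_vector_mul_assoc[symmetric] x(1) y(1))
  show "1 \<bullet> (Hk P M k *v (Dx P M k *v w)) = 1 \<bullet> (Ex P M k *v w)"
    and "1 \<bullet> (Hk P M k *v (Dy P M k *v w)) = 1 \<bullet> (Ey P M k *v w)"
    using x(2)[of w] y(2)[of w] Hk_mult_matrix_inv[OF P M, of k]
    by (simp_all add: Dx_def Dy_def matrix_vector_mul_assoc[symmetric])
qed

lemma Df_one:
  assumes P: "sbp_operator p P" and M: "conforming_mesh p P A M"
  shows "Df P M A' k i *v 1 = 0"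
  by (simp add: Df_def flux_x_def flux_y_def matrix_vector_mult_add_rdistrib
      matrix_vector_mul_assoc[symmetric] Dx_Dy_conservation[OF P M])

text \<open>Since \<open>Rf\<close> maps 1 to 1, the outer extrapolation disappears, and on each
  facet the \<open>x\<close> and \<open>y\<close> contributions join to the normal flux
  \<open>Df\<close>.\<close>

lemma inner_one_Hk_D2:
  assumes P: "sbp_operator p P" and M: "conforming_mesh p P A M"
  shows "1 \<bullet> (Hk P M k *v (D2 P M A' k *v w)) = (\<Sum>i\<in>UNIV. 1 \<bullet> (Bf P M k i *v (Df P M A' k i *v w)))"
proof -
  have "1 \<bullet> (Hk P M k *v (D2 P M A' k *v w))
      = 1 \<bullet> (Ex P M k *v (flux_x P M A' k *v w)) + 1 \<bullet> (Ey P M k *v (flux_y P M A' k *v w))"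
    using Dx_Dy_conservation(3,4)[OF P M]
    by (simp add: D2_def matrix_vector_mult_add_rdistrib matrix_vector_right_distrib
        matrix_vector_mul_assoc[symmetric] inner_add_right)
  also have "\<dots> = (\<Sum>i\<in>UNIV. 1 \<bullet> (Bf P M k i *v (Df P M A' k i *v w)))"
    unfolding Ex_def Ey_def sum_matrix_vector_mult inner_sum_right sum.distrib[symmetric]
    by (simp add: matrix_vector_mul_assoc[symmetric] inner_matrix_vector_mult[of 1 "transpose _"]
        transpose_transpose Rf_one[OF P] Df_def matrix_vector_mult_add_rdistrib
        matrix_vector_right_distrib inner_add_right)
  finally show ?thesis .
qed

section \<open>Summation over facets\<close>

text \<open>Sums over pairs can be reindexed across elements, which the exchange of facet sides
  requires.\<close>

lemma sum_facet_pairs: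
  fixes Q :: "'k::finite \<Rightarrow> 3 \<Rightarrow> bool"
  shows "(\<Sum>k\<in>UNIV. \<Sum>i | Q k i. g k i) = (\<Sum>(k, i) | Q k i. g k i)"
proof -
  have "Sigma UNIV (\<lambda>k. {i. Q k i}) = {(k, i). Q k i}"
    by auto
  then show ?thesis
    using sum.Sigma[of UNIV "\<lambda>k. {i. Q k i}" g] by simp
qed

lemma adjacent_sym: "adjacent M k i v j \<Longrightarrow> adjacent M v j k i"
  by (auto simp: adjacent_def)

lemma adjacent_imp_interior_facet: "adjacent M k i v j \<Longrightarrow> interior_facet M k i"
  by (auto simp: interior_facet_def)

lemma neighbour_eq:
  assumes "conforming_mesh p P A M" "adjacent M k i v j"
  shows "neighbour M k i = (v, j)"
proof -
  have "\<forall>k i. interior_facet M k i \<longrightarrow> (\<exists>!vj. adjacent M k i (fst vj) (snd vj))"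
    using assms(1) unfolding conforming_mesh_def by (elim conjE)
  from this[rule_format, OF adjacent_imp_interior_facet[OF assms(2)]] show ?thesis
    unfolding neighbour_def by (rule the1_equality) (simp add: assms(2))
qed

lemma interior_facet_neighbourE:
  assumes "conforming_mesh p P A M" "interior_facet M k i"
  obtains v j where "adjacent M k i v j" "interior_facet M v j"
    "neighbour M k i = (v, j)" "neighbour M v j = (k, i)"
proof -
  obtain v j where "adjacent M k i v j"
    using assms(2) unfolding interior_facet_def by blast
  then show thesis
    by (intro that[of v j])
      (blast intro: adjacent_sym adjacent_imp_interior_facet neighbour_eq[OF assms(1)])+
qed

text \<open>Passing to the other side is an involution on the interior pairs of element and
  facet.\<close>

lemma sum_neighbour:
  fixes M :: "('k::finite, 'f::finite) mesh"
  assumes M: "conforming_mesh p P A M"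
  shows "(\<Sum>(k, i) | interior_facet M k i. case neighbour M k i of (v, j) \<Rightarrow> g v j)
       = (\<Sum>(k, i) | interior_facet M k i. g k i)"
proof (rule sum.reindex_bij_witness[where i = "case_prod (neighbour M)" and j = "case_prod (neighbour M)"])
  fix a assume "a \<in> {(k, i). interior_facet M k i}"
  then obtain k i where a: "a = (k, i)" "interior_facet M k i"
    by auto
  from interior_facet_neighbourE[OF M a(2)] obtain v j where "interior_facet M v j"
    "neighbour M k i = (v, j)" "neighbour M v j = (k, i)" .
  then show "case_prod (neighbour M) (case_prod (neighbour M) a) = a"
    "case_prod (neighbour M) (case_prod (neighbour M) a) = a"
    "case_prod (neighbour M) a \<in> {(k, i). interior_facet M k i}"
    "case_prod (neighbour M) a \<in> {(k, i). interior_facet M k i}"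
    "(case case_prod (neighbour M) a of (k, i) \<Rightarrow> g k i)
      = (case a of (k, i) \<Rightarrow> case neighbour M k i of (v, j) \<Rightarrow> g v j)"
    by (simp_all add: a)
qed

section \<open>Penalty terms tested with the constant 1\<close>

lemma inner_one_transpose_Rf:
  assumes "sbp_operator p P"
  shows "1 \<bullet> (transpose (Rf P M k i) *v x) = 1 \<bullet> x"
  by (simp add: inner_matrix_vector_mult[of 1 "transpose _"] Rf_one[OF assms])

lemma inner_one_transpose_Df:
  assumes "sbp_operator p P" "conforming_mesh p P A M"
  shows "1 \<bullet> (transpose (Df P M A' k i) *v x) = 0"
  by (simp add: inner_matrix_vector_mult[of 1 "transpose _"] Df_one[OF assms])

lemma sum_inner_one_sat_interior:
  fixes P :: "('n::finite, 'f::finite) sbp_op" and M :: "('k::finite, 'f) mesh"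
  assumes P: "sbp_operator p P" and M: "conforming_mesh p P A M"
    and T1: "\<And>k i v j. adjacent M k i v j \<Longrightarrow> T1 T k i = T1 T v j"
    and T3: "\<And>k i v j. adjacent M k i v j \<Longrightarrow> T3 T k i + T3 T v j = Bf P M k i"
    and T5: "\<And>k a b. interior_facet M k a \<Longrightarrow> interior_facet M k b \<Longrightarrow> a \<noteq> b \<Longrightarrow>
           T5 T k a b = - T6 T k a b"
  shows "(\<Sum>k\<in>UNIV. 1 \<bullet> sat_interior P M A' T u k)
       = (\<Sum>(k, i) | interior_facet M k i. 1 \<bullet> (Bf P M k i *v (Df P M A' k i *v u k)))"
proof -
  define jmp where "jmp = jump P M u"
  define fjmp where "fjmp = flux_jump P M A' u"
  let ?w = "\<lambda>k i. Df P M A' k i *v u k"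
  have jmp: "jmp v j = - jmp k i" "fjmp v j = fjmp k i" "fjmp k i = ?w k i + ?w v j"
    if "neighbour M k i = (v, j)" "neighbour M v j = (k, i)" for k i v j
    using that by (simp_all add: jmp_def jump_def fjmp_def flux_jump_def add.commute)

  \<comment> \<open>The jump is odd under exchange of the two sides of a facet, the flux jump is even.\<close>
  define s1 where "s1 k i = 1 \<bullet> (T1 T k i *v jmp k i)" for k i
  have "(\<Sum>(k, i) | interior_facet M k i. s1 k i)
      = (\<Sum>(k, i) | interior_facet M k i. - s1 k i)"
    unfolding sum_neighbour[OF M, of s1, symmetric]
  proof (rule sum.cong[OF refl], clarify)
    fix k i assume "interior_facet M k i"
    from interior_facet_neighbourE[OF M this] obtain v j where adj: "adjacent M k i v j"
      and n: "neighbour M k i = (v, j)" "neighbour M v j = (k, i)" .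
    show "(case neighbour M k i of (v, j) \<Rightarrow> s1 v j) = - s1 k i"
      by (simp add: n s1_def jmp(1)[OF n] T1[OF adj] matrix_vector_mult_uminus)
  qed
  then have S1: "(\<Sum>(k, i) | interior_facet M k i. s1 k i) = 0"
    by (simp add: case_prod_unfold sum_negf)

  define s3 where "s3 k i = 1 \<bullet> (T3 T k i *v fjmp k i)" for k i
  define b where "b k i = 1 \<bullet> (Bf P M k i *v ?w k i)" for k i
  have "s3 k i + (case neighbour M k i of (v, j) \<Rightarrow> s3 v j)
      = b k i + (case neighbour M k i of (v, j) \<Rightarrow> b v j)" if "interior_facet M k i" for k i
  proof -
    from interior_facet_neighbourE[OF M that] obtain v j where adj: "adjacent M k i v j"
      and n: "neighbour M k i = (v, j)" "neighbour M v j = (k, i)" .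
    \<comment> \<open>The hypothesis on \<open>T3\<close>, read from both sides, makes \<open>Bf\<close> independent of the side.\<close>
    have B: "Bf P M v j = Bf P M k i"
      using T3[OF adj] T3[OF adjacent_sym[OF adj]] by (simp add: add.commute)
    have "s3 k i + s3 v j = 1 \<bullet> ((T3 T k i + T3 T v j) *v fjmp k i)"
      by (simp add: s3_def jmp(2)[OF n] matrix_vector_mult_add_rdistrib inner_add_right)
    also have "\<dots> = b k i + b v j"
      by (simp add: T3[OF adj] b_def B jmp(3)[OF n] matrix_vector_right_distrib inner_add_right)
    finally show ?thesis
      by (simp add: n)
  qed
  then have "(\<Sum>(k, i) | interior_facet M k i. s3 k i + (case neighbour M k i of (v, j) \<Rightarrow> s3 v j))
      = (\<Sum>(k, i) | interior_facet M k i. b k i + (case neighbour M k i of (v, j) \<Rightarrow> b v j))"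
    by (intro sum.cong) auto
  \<comment> \<open>By exchange of sides, both totals are twice the corresponding one-sided sums;
    the factor 2 cancels.\<close>
  then have S3: "(\<Sum>(k, i) | interior_facet M k i. s3 k i) = (\<Sum>(k, i) | interior_facet M k i. b k i)"
    using sum_neighbour[OF M, of s3] sum_neighbour[OF M, of b]
    by (simp add: case_prod_unfold sum.distrib)

  \<comment> \<open>The \<open>T6\<close> terms of an element refer to the facets of its neighbour,
    hence enter as \<open>s6 v j\<close>. After exchange of sides they carry the same indices as
    \<open>s5\<close>, and the hypothesis on \<open>T5\<close> applies termwise.\<close>
  define s5 where "s5 k i = (\<Sum>e | e \<noteq> i \<and> interior_facet M k e. 1 \<bullet> (T5 T k i e *v jmp k e))" for k i
  define s6 where "s6 k i = (\<Sum>e | e \<noteq> i \<and> interior_facet M k e. 1 \<bullet> (T6 T k i e *v jmp k e))" for k i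
  have "s5 k i = - s6 k i" if "interior_facet M k i" for k i
    unfolding s5_def s6_def sum_negf[symmetric]
    by (intro sum.cong) (auto simp: T5[OF that] uminus_matrix_vector_mult)
  then have "(\<Sum>(k, i) | interior_facet M k i. s5 k i) = (\<Sum>(k, i) | interior_facet M k i. - s6 k i)"
    by (intro sum.cong) auto
  then have S5: "(\<Sum>(k, i) | interior_facet M k i. s5 k i + (case neighbour M k i of (v, j) \<Rightarrow> s6 v j)) = 0"
    using sum_neighbour[OF M, of s6] by (simp add: case_prod_unfold sum.distrib sum_negf)

  \<comment> \<open>Testing with 1 strips \<open>transpose Rf\<close> and annihilates every term
    behind \<open>transpose Df\<close>, which leaves four scalar families.\<close>
  have "1 \<bullet> sat_interior P M A' T u k = (\<Sum>i | interior_facet M k i. s1 k i + s3 k i)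
      + (\<Sum>i | interior_facet M k i. s5 k i + (case neighbour M k i of (v, j) \<Rightarrow> s6 v j))" for k
    unfolding sat_interior_def jmp_def[symmetric] fjmp_def[symmetric]
    by (simp add: inner_add_right inner_sum_right inner_one_transpose_Rf[OF P] Let_def
        inner_one_transpose_Df[OF P M] s1_def s3_def s5_def s6_def case_prod_unfold)
  then have "(\<Sum>k\<in>UNIV. 1 \<bullet> sat_interior P M A' T u k)
      = (\<Sum>(k, i) | interior_facet M k i. s1 k i + s3 k i)
      + (\<Sum>(k, i) | interior_facet M k i. s5 k i + (case neighbour M k i of (v, j) \<Rightarrow> s6 v j))"
    by (simp add: sum.distrib sum_facet_pairs[symmetric])
  with S1 S3 S5 show ?thesis
    by (simp add: case_prod_unfold sum.distrib b_def)
qed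

text \<open>Written as all boundary fluxes minus the target, so that the fluxes can cancel those of
  the volume terms. The Dirichlet flux is added here to balance its occurrence in
  \<open>boundary_terms\<close>.\<close>

lemma sum_inner_one_sat_boundary:
  fixes P :: "('n::finite, 'f::finite) sbp_op" and M :: "('k::finite, 'f) mesh"
  assumes P: "sbp_operator p P" and M: "conforming_mesh p P A M"
  shows "(\<Sum>k\<in>UNIV. 1 \<bullet> sat_boundary P M A T t u k)
       = (\<Sum>(k, i) | D_facet M A k i. 1 \<bullet> (Bf P M k i *v (Df P M A k i *v u k)))
       + (\<Sum>(k, i) | N_facet M A k i. 1 \<bullet> (Bf P M k i *v (Df P M A k i *v u k)))
       - boundary_terms P M A T t u"
proof -
  have "1 \<bullet> sat_boundary P M A T t u k
      = (\<Sum>i | D_facet M A k i. 1 \<bullet> (TD T k i *v (Rf P M k i *v u k - dirichlet_data P M A t k i)))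
      + (\<Sum>i | N_facet M A k i. 1 \<bullet> (Bf P M k i *v (Df P M A k i *v u k))
          - 1 \<bullet> (Bf P M k i *v neumann_data P M A t k i))" for k
    unfolding sat_boundary_def
    by (simp add: inner_add_right inner_sum_right inner_one_transpose_Rf[OF P] Let_def
        inner_one_transpose_Df[OF P M] matrix_vector_mult_diff_distrib[of "Bf P M k _"] inner_diff_right)
  then show ?thesis
    by (simp add: sum.distrib sum_facet_pairs boundary_terms_def inner_one_transpose_Rf[OF P]
        case_prod_unfold sum_subtractf)
qed

lemma sum_all_facets:
  fixes M :: "('k::finite, 'f::finite) mesh" and g :: "'k \<Rightarrow> 3 \<Rightarrow> real"
  assumes M: "conforming_mesh p P A M"
  shows "(\<Sum>k\<in>UNIV. \<Sum>i\<in>UNIV. g k i) = (\<Sum>(k, i) | interior_facet M k i. g k i)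
       + (\<Sum>(k, i) | D_facet M A k i. g k i) + (\<Sum>(k, i) | N_facet M A k i. g k i)"
proof -
  let ?I = "{(k, i). interior_facet M k i}"
  let ?D = "{(k, i). D_facet M A k i}"
  let ?N = "{(k, i). N_facet M A k i}"
  have part: "interior_facet M k i \<or> D_facet M A k i \<or> N_facet M A k i"
    "\<not> (interior_facet M k i \<and> D_facet M A k i)" "\<not> (interior_facet M k i \<and> N_facet M A k i)"
    "\<not> (D_facet M A k i \<and> N_facet M A k i)" for k i
    using M unfolding conforming_mesh_def by blast+
  have "(\<Sum>k\<in>UNIV. \<Sum>i\<in>UNIV. g k i) = (\<Sum>(k, i)\<in>?I \<union> ?D \<union> ?N. g k i)"
    unfolding sum.cartesian_product using part(1) by (intro sum.cong) auto
  also have "\<dots> = (\<Sum>(k, i)\<in>?I \<union> ?D. g k i) + (\<Sum>(k, i)\<in>?N. g k i)"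
    using part(2-) by (intro sum.union_disjoint) auto
  also have "(\<Sum>(k, i)\<in>?I \<union> ?D. g k i) = (\<Sum>(k, i)\<in>?I. g k i) + (\<Sum>(k, i)\<in>?D. g k i)"
    using part(2-) by (intro sum.union_disjoint) auto
  finally show ?thesis .
qed

section \<open>Assembly of the global balance\<close>

text \<open>Conservation concerns the problem with its source set to zero; this update must be seen
  to leave the operators and penalty terms unchanged.\<close>

lemma Df_source_update [simp]: "Df P M (A\<lparr>source := f\<rparr>) = Df P M A"
  by (simp add: fun_eq_iff Df_def flux_x_def flux_y_def Lam_def)

lemma D2_source_update [simp]: "D2 P M (A\<lparr>source := f\<rparr>) = D2 P M A"
  by (simp add: fun_eq_iff D2_def flux_x_def flux_y_def Lam_def)

lemma sat_source_update [simp]: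
  "sat_interior P M (A\<lparr>source := f\<rparr>) = sat_interior P M A"
  "sat_boundary P M (A\<lparr>source := f\<rparr>) = sat_boundary P M A"
  by (simp_all add: fun_eq_iff sat_interior_def flux_jump_def sat_boundary_def D_facet_def
      N_facet_def dirichlet_data_def neumann_data_def)

theorem theorem3:
  fixes p :: nat
    and P :: "('n::finite, 'f::finite) sbp_op"
    and A :: problem
    and M :: "('k::finite, 'f) mesh"
    and T :: "('k, 'f) penalty"
  assumes "diffusion_problem A"
    and "sbp_operator p P"
    and "conforming_mesh p P A M"
    and "\<And>k i v j. adjacent M k i v j \<Longrightarrow> T1 T k i = T1 T v j"
    and "\<And>k i v j. adjacent M k i v j \<Longrightarrow> T3 T k i + T3 T v j = Bf P M k i"
    and "\<And>k a b. interior_facet M k a \<Longrightarrow> interior_facet M k b \<Longrightarrow> a \<noteq> b \<Longrightarrow>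
           T5 T k a b = - T6 T k a b"
  shows "conservative P M A T"
  unfolding conservative_def
proof (intro allI impI, elim conjE)
  note P = assms(2) and M = assms(3)
  fix u :: "'k \<Rightarrow> real \<Rightarrow> real^'n" and t :: real
  let ?rhs = "sbp_sat_rhs P M (A\<lparr>source := \<lambda>_ _. 0\<rparr>) T t (\<lambda>l. u l t)"
  assume t: "0 \<le> t" and u: "\<forall>k. (u k has_vector_derivative ?rhs k) (at t within {0..})"
  \<comment> \<open>A derivative within \<open>{0..}\<close> is unique only at a limit point of that
    set; the right end \<open>t + 1\<close> also covers the one-sided case
    \<open>t = 0\<close>.\<close>
  have "t islimpt {0..t + 1}"
    using t by (simp add: islimpt_Icc)
  then have "at t within {0..} \<noteq> bot"
    using islimpt_subset[of t "{0..t + 1}" "{0..}"] by (simp add: trivial_limit_within subset_iff)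
  then have du: "vector_derivative (u k) (at t within {0..}) = ?rhs k" for k
    using u by (blast intro: vector_derivative_within)
  have "1 \<bullet> (Hk P M k *v ?rhs k)
      = (\<Sum>i\<in>UNIV. 1 \<bullet> (Bf P M k i *v (Df P M A k i *v u k t)))
        - 1 \<bullet> sat_interior P M A T (\<lambda>l. u l t) k - 1 \<bullet> sat_boundary P M A T t (\<lambda>l. u l t) k" for k
  proof -
    have "at_nodes P (\<lambda>_. 0) = 0"
      by (simp add: at_nodes_def vec_eq_iff)
    then show ?thesis
      by (simp add: sbp_sat_rhs_def matrix_vector_mult_diff_distrib inner_diff_right
          inner_one_Hk_D2[OF P M] Hk_mult_matrix_inv[OF P M])
  qed
  \<comment> \<open>The volume fluxes are split by facet type: the interior ones equal the interior
    penalty sum, the Dirichlet and Neumann ones cancel against the boundary penalty sum up to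
    \<open>boundary_terms\<close>.\<close>
  then have "(\<Sum>k\<in>UNIV. 1 \<bullet> (Hk P M k *v ?rhs k)) = boundary_terms P M A T t (\<lambda>l. u l t)"
    by (simp add: sum_subtractf sum_all_facets[OF M] sum_inner_one_sat_interior[OF P M assms(4-6)]
        sum_inner_one_sat_boundary[OF P M])
  then show "(\<Sum>k\<in>UNIV. 1 \<bullet> (Hk P M k *v vector_derivative (u k) (at t within {0..})))
      = boundary_terms P M A T t (\<lambda>l. u l t)"
    by (simp add: du)
qed

end
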